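(* Let $G$ be a connected bipartite graph with at least one vertex of degree $1$. Then $G$ has exactly four distinct normalized Laplacian eigenvalues if and only if $G$ is the graph obtained from the disjoint union $G'\cup K_2$ by joining one vertex of $K_2$ to every vertex of one part (color class) of $G'$, where either $G'=K_2$, or $G'$ is the incidence graph of the complement of a Hadamard design (i.e. the incidence graph of a symmetric BIBD with parameters $(4t-1,2t,t)$ for some positive integer $t$).
   Context: A balanced incomplete block design (BIBD) is a pair $(V,\mathcal{B})$ where $V$ is a $v$-set and $\mathcal{B}$ is a collection of $b$ $k$-subsets (blocks) of $V$ such that each element lies in exactly $r$ blocks and each pair of distinct elements lies in exactly $\lambda$ blocks. It is symmetric with parameters $(v,k,\lambda)$ if $r=k$ (hence $b=v$). The complement of $(V,\mathcal{B})$ is $(V,\{V\setminus B: B\in\mathcal{B}\})$. A Hadamard design of dimension $t$ is a symmetric BIBD with parameters $(4t-1,2t-1,t-1)$; its complement is a symmetric BIBD with parameters $(4t-1,2t,t)$. The incidence graph of $(V,\mathcal{B})$ is the bipartite graph with vertex set $V\cup\mathcal{B}$ in which $x\in V$ and $B\in\mathcal{B}$ are adjacent iff $x\in B$. For a graph with adjacency matrix $A$ and diagonal degree matrix $D$ (no isolated vertices), the normalized Laplacian is $\mathcal{L}=I-D^{-1/2}AD^{-1/2}$, and its eigenvalues are the normalized Laplacian eigenvalues. *)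

theory Defs
  imports "Jordan_Normal_Form.Char_Poly"
begin

section \<open>Finite simple graphs on the vertex set {0..<n}\<close>

definition simple_graph :: "nat \<Rightarrow> (nat \<Rightarrow> nat \<Rightarrow> bool) \<Rightarrow> bool" where
  "simple_graph n E \<longleftrightarrow> (\<forall>x y. E x y \<longrightarrow> x < n \<and> y < n \<and> x \<noteq> y \<and> E y x)"

definition graph_degree :: "nat \<Rightarrow> (nat \<Rightarrow> nat \<Rightarrow> bool) \<Rightarrow> nat \<Rightarrow> nat" where
  "graph_degree n E v = card {u. u < n \<and> E v u}"

definition connected_graph :: "nat \<Rightarrow> (nat \<Rightarrow> nat \<Rightarrow> bool) \<Rightarrow> bool" where
  "connected_graph n E \<longleftrightarrow> (\<forall>x<n. \<forall>y<n. (x, y) \<in> {(a, b). E a b}\<^sup>*)"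

definition bipartite_graph :: "nat \<Rightarrow> (nat \<Rightarrow> nat \<Rightarrow> bool) \<Rightarrow> bool" where
  "bipartite_graph n E \<longleftrightarrow> (\<exists>S. \<forall>x<n. \<forall>y<n. E x y \<longrightarrow> (x \<in> S \<longleftrightarrow> y \<notin> S))"

text \<open>Normalized Laplacian I - D^(-1/2) A D^(-1/2) as an n x n real matrix.\<close>
definition norm_laplacian :: "nat \<Rightarrow> (nat \<Rightarrow> nat \<Rightarrow> bool) \<Rightarrow> real mat" where
  "norm_laplacian n E = mat n n (\<lambda>(i, j).
     (if i = j then 1 else 0)
     - (if E i j then 1 / sqrt (real (graph_degree n E i) * real (graph_degree n E j)) else 0))"

definition nlap_eigenvalues :: "nat \<Rightarrow> (nat \<Rightarrow> nat \<Rightarrow> bool) \<Rightarrow> real set" where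
  "nlap_eigenvalues n E = {\<mu>. eigenvalue (norm_laplacian n E) \<mu>}"

section \<open>Graphs on arbitrary vertex sets, isomorphism\<close>

definition graph_iso :: "'a set \<Rightarrow> ('a \<Rightarrow> 'a \<Rightarrow> bool) \<Rightarrow> 'b set \<Rightarrow> ('b \<Rightarrow> 'b \<Rightarrow> bool) \<Rightarrow> ('a \<Rightarrow> 'b) \<Rightarrow> bool" where
  "graph_iso V1 E1 V2 E2 f \<longleftrightarrow> bij_betw f V1 V2 \<and> (\<forall>x\<in>V1. \<forall>y\<in>V1. E1 x y \<longleftrightarrow> E2 (f x) (f y))"

text \<open>S is one part (color class) of the bipartite graph (W, F).\<close>
definition is_color_class :: "'a set \<Rightarrow> ('a \<Rightarrow> 'a \<Rightarrow> bool) \<Rightarrow> 'a set \<Rightarrow> bool" where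
  "is_color_class W F S \<longleftrightarrow> S \<subseteq> W \<and> S \<noteq> {} \<and> W - S \<noteq> {} \<and>
     (\<forall>x\<in>W. \<forall>y\<in>W. F x y \<longrightarrow> (x \<in> S \<longleftrightarrow> y \<notin> S))"

definition is_K2 :: "'a set \<Rightarrow> ('a \<Rightarrow> 'a \<Rightarrow> bool) \<Rightarrow> bool" where
  "is_K2 W F \<longleftrightarrow> (\<exists>a b. W = {a, b} \<and> a \<noteq> b \<and> F a b)"

section \<open>Block designs (blocks given as an indexed family, i.e. a collection)\<close>

definition bibd :: "'p set \<Rightarrow> 'b set \<Rightarrow> ('b \<Rightarrow> 'p set) \<Rightarrow> nat \<Rightarrow> nat \<Rightarrow> nat \<Rightarrow> nat \<Rightarrow> nat \<Rightarrow> bool" where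
  "bibd P I blk v b r k lam \<longleftrightarrow>
     finite P \<and> card P = v \<and> finite I \<and> card I = b \<and>
     (\<forall>i\<in>I. blk i \<subseteq> P \<and> card (blk i) = k) \<and>
     (\<forall>x\<in>P. card {i\<in>I. x \<in> blk i} = r) \<and>
     (\<forall>x\<in>P. \<forall>y\<in>P. x \<noteq> y \<longrightarrow> card {i\<in>I. x \<in> blk i \<and> y \<in> blk i} = lam)"

definition symmetric_bibd :: "'p set \<Rightarrow> 'b set \<Rightarrow> ('b \<Rightarrow> 'p set) \<Rightarrow> nat \<Rightarrow> nat \<Rightarrow> nat \<Rightarrow> bool" where
  "symmetric_bibd P I blk v k lam \<longleftrightarrow> bibd P I blk v v k k lam"

definition hadamard_design :: "'p set \<Rightarrow> 'b set \<Rightarrow> ('b \<Rightarrow> 'p set) \<Rightarrow> nat \<Rightarrow> bool" where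
  "hadamard_design P I blk t \<longleftrightarrow> symmetric_bibd P I blk (4 * t - 1) (2 * t - 1) (t - 1)"

definition complement_design :: "'p set \<Rightarrow> ('b \<Rightarrow> 'p set) \<Rightarrow> ('b \<Rightarrow> 'p set)" where
  "complement_design P blk = (\<lambda>i. P - blk i)"

text \<open>Incidence graph: vertices are points (Inl) and blocks (Inr).\<close>
definition incidence_vertices :: "'p set \<Rightarrow> 'b set \<Rightarrow> ('p + 'b) set" where
  "incidence_vertices P I = Inl ` P \<union> Inr ` I"

fun incidence_adj :: "('b \<Rightarrow> 'p set) \<Rightarrow> ('p + 'b) \<Rightarrow> ('p + 'b) \<Rightarrow> bool" where
  "incidence_adj blk (Inl x) (Inr i) = (x \<in> blk i)"
| "incidence_adj blk (Inr i) (Inl x) = (x \<in> blk i)"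
| "incidence_adj blk _ _ = False"

section \<open>The graphs of the characterization\<close>

text \<open>(n, E) is obtained from G' \<union> K2 (K2 on the vertices w, z) by joining w to every
  vertex of a color class S of G', where G' is the induced subgraph on the remaining
  vertices and G' is K2 or the incidence graph of the complement of a Hadamard design.\<close>
definition obtained_graph :: "nat \<Rightarrow> (nat \<Rightarrow> nat \<Rightarrow> bool) \<Rightarrow> bool" where
  "obtained_graph n E \<longleftrightarrow>
    (\<exists>w z S. w < n \<and> z < n \<and> w \<noteq> z \<and> E w z \<and>
       (\<forall>u<n. E z u \<longleftrightarrow> u = w) \<and>
       (\<forall>u<n. E w u \<longleftrightarrow> u = z \<or> u \<in> S) \<and>
       (let W = {0..<n} - {w, z}; F = (\<lambda>x y. x \<in> W \<and> y \<in> W \<and> E x y) in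
         is_color_class W F S \<and>
         (is_K2 W F \<or>
          (\<exists>t\<ge>1. \<exists>(P :: nat set) (I :: nat set) blk f.
             hadamard_design P I blk t \<and>
             graph_iso W F (incidence_vertices P I)
               (incidence_adj (complement_design P blk)) f))))"

end

theory Submission
  imports Defs "HOL-Analysis.Function_Topology"
begin

text \<open>
  Conjugating by \<open>D^(1/2)\<close>, the eigenvalues of the normalized Laplacian are the numbers \<open>1 - l\<close> with \<open>l\<close>
  an eigenvalue of the averaging operator \<open>P = D^(-1) A\<close>, which is self-adjoint for the inner product
  weighted by the degrees. For a connected bipartite graph the spectrum of \<open>P\<close> is symmetric and contains
  \<open>1\<close> and \<open>-1\<close>, so four distinct eigenvalues means spectrum \<open>{1, -1, t, -t}\<close> with \<open>0 < t < 1\<close>, i.e.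
  \<open>(P\<^sup>2 - 1) (P\<^sup>2 - t\<^sup>2) = 0\<close>. As the kernel of \<open>P\<^sup>2 - 1\<close> consists of the functions constant on each part,
  this says that for some \<open>c > 0\<close> and all \<open>x\<close>, \<open>y\<close> in the same part the sum of \<open>1 / deg u\<close> over the common
  neighbours \<open>u\<close> of \<open>x\<close> and \<open>y\<close> is \<open>c deg x deg y\<close>, plus \<open>t\<^sup>2 deg x\<close> if \<open>x = y\<close>. Comparing traces on the two parts
  shows that they have the same size. If \<open>z\<close> has degree 1 and neighbour \<open>w\<close>, the identity makes \<open>w\<close> adjacent to the
  whole part of \<open>z\<close>, makes degrees constant on both parts apart from \<open>z\<close> and \<open>w\<close>, and makes the rest of
  the graph an incidence structure with \<open>2s - 1\<close> points and blocks, block size \<open>s\<close> and pair count \<open>s / 2\<close>: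
  this is \<open>K\<^sub>2\<close> for \<open>s = 1\<close>, and a complement of a Hadamard design otherwise. All steps can be reversed.
\<close>

section \<open>Self-adjoint operators on finitely supported functions\<close>

definition weighted_inner :: "nat \<Rightarrow> (nat \<Rightarrow> real) \<Rightarrow> (nat \<Rightarrow> real) \<Rightarrow> (nat \<Rightarrow> real) \<Rightarrow> real" where
  "weighted_inner n d f g = (\<Sum>x<n. d x * f x * g x)"

lemma weighted_inner_commute: "weighted_inner n d f g = weighted_inner n d g f"
  by (simp add: weighted_inner_def mult_ac)

lemma weighted_inner_add_right:
  "weighted_inner n d f (\<lambda>x. s * g x + t * h x) = s * weighted_inner n d f g + t * weighted_inner n d f h"
  by (simp add: weighted_inner_def sum.distrib sum_distrib_left algebra_simps)

lemma weighted_inner_add_left: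
  "weighted_inner n d (\<lambda>x. s * g x + t * h x) f = s * weighted_inner n d g f + t * weighted_inner n d h f"
  by (simp add: weighted_inner_def sum.distrib sum_distrib_left algebra_simps)

lemma weighted_inner_scale_left: "weighted_inner n d (\<lambda>x. s * g x) f = s * weighted_inner n d g f"
  by (simp add: weighted_inner_def sum_distrib_left algebra_simps)

lemma weighted_inner_scale_right: "weighted_inner n d f (\<lambda>x. s * g x) = s * weighted_inner n d f g"
  by (simp add: weighted_inner_def sum_distrib_left algebra_simps)

lemma weighted_inner_nonneg:
  assumes "\<And>x. x < n \<Longrightarrow> d x > 0"
  shows "weighted_inner n d f f \<ge> 0"
  unfolding weighted_inner_def
  by (intro sum_nonneg) (use assms in \<open>auto simp: mult.assoc intro!: mult_nonneg_nonneg[OF less_imp_le zero_le_square]\<close>)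

lemma weighted_inner_eq_0:
  assumes "\<And>x. x < n \<Longrightarrow> d x > 0" and "weighted_inner n d f f = 0" and "x < n"
  shows "f x = 0"
proof -
  have "\<forall>x\<in>{..<n}. d x * f x * f x = 0"
    using assms(2) unfolding weighted_inner_def
    by (subst (asm) sum_nonneg_eq_0_iff)
      (use assms(1) in \<open>auto simp: mult.assoc intro!: mult_nonneg_nonneg[OF less_imp_le zero_le_square]\<close>)
  then show ?thesis using assms(1,3) by force
qed

lemma continuous_on_weighted_inner [continuous_intros]:
  assumes "\<And>x. continuous_on S (\<lambda>f. F f x)" "\<And>x. continuous_on S (\<lambda>f. G f x)"
  shows "continuous_on S (\<lambda>f. weighted_inner n d (F f) (G f))"
  unfolding weighted_inner_def by (intro continuous_intros assms)

text \<open>The first-order condition at a maximiser of the Rayleigh quotient.\<close>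

lemma nonneg_quadratic_linear_coeff_0:
  fixes a b :: real
  assumes "\<And>t. 0 \<le> a * t\<^sup>2 + b * t"
  shows "b = 0"
proof (rule ccontr)
  assume b: "b \<noteq> 0"
  \<comment> \<open>Positive and strictly above \<open>a\<close>, so that at
    \<open>t = - b / A\<close> the linear term outweighs the quadratic one.\<close>
  define A where "A = \<bar>a\<bar> + 1"
  have A: "A > 0" "a < A" by (auto simp: A_def)
  have "0 \<le> a * (- b / A)\<^sup>2 + b * (- b / A)" by (rule assms)
  also have "\<dots> = (b\<^sup>2 / A) * (a / A - 1)"
    using A by (simp add: field_simps power2_eq_square)
  also have "\<dots> < 0"
    using A b by (intro mult_pos_neg) (auto simp: field_simps)
  finally show False by simp
qed

text \<open>A maximiser of the Rayleigh quotient on the unit sphere of the subspace is an eigenfunction;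
  the sphere is compact in the product topology because its elements vanish beyond \<open>n\<close>.\<close>
lemma exists_eigenfunction_in_subspace:
  fixes a :: "nat \<Rightarrow> nat \<Rightarrow> real" and d :: "nat \<Rightarrow> real"
  assumes d: "\<And>x. x < n \<Longrightarrow> d x > 0"
    and T: "\<And>f x. T f x = (\<Sum>y<n. a x y * f y)"
    and self: "\<And>f g. weighted_inner n d (T f) g = weighted_inner n d f (T g)"
    and W: "closed W" "\<And>f x. f \<in> W \<Longrightarrow> x \<ge> n \<Longrightarrow> f x = 0"
      "\<And>f g s t. f \<in> W \<Longrightarrow> g \<in> W \<Longrightarrow> (\<lambda>x. s * f x + t * g x) \<in> W"
    and inv: "\<And>f. f \<in> W \<Longrightarrow> T f \<in> W"
    and h: "h \<in> W" "h \<noteq> (\<lambda>_. 0)"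
  shows "\<exists>f\<in>W. f \<noteq> (\<lambda>_. 0) \<and> (\<exists>l. T f = (\<lambda>x. l * f x))"
proof -
  let ?ip = "weighted_inner n d"
  have scale: "(\<lambda>x. s * f x) \<in> W" if "f \<in> W" for f s
    using W(3)[OF that that, of s 0] by simp
  have pos: "?ip f f > 0" if f: "f \<in> W" "f \<noteq> (\<lambda>_. 0)" for f
  proof -
    have "?ip f f \<noteq> 0"
    proof
      assume "?ip f f = 0"
      then have "f x = 0" for x
        using weighted_inner_eq_0[of n d f x] d W(2)[OF f(1), of x] by (cases "x < n") auto
      with f(2) show False by auto
    qed
    then show ?thesis using weighted_inner_nonneg[of n d f] d by force
  qed
  \<comment> \<open>On the unit sphere each summand \<open>d x * (f x)^2\<close> is at most 1,
    whence this bound on the coordinates; \<open>B\<close> is compact by Tychonoff.\<close>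
  define b where "b x = 1 / sqrt (d x)" for x
  define B where "B = (\<Pi>\<^sub>E x\<in>(UNIV::nat set). if x < n then {- b x..b x} else {0})"
  have "compact B"
  proof -
    have "compactin (product_topology (\<lambda>i::nat. euclidean :: real topology) UNIV) B"
      unfolding B_def compactin_PiE by auto
    then show ?thesis by (simp add: euclidean_product_topology)
  qed
  define K where "K = W \<inter> {f. ?ip f f = 1}"
  have "closed {f. ?ip f f = 1}"
    by (intro closed_Collect_eq continuous_intros) auto
  moreover have KB: "K \<subseteq> B"
  proof
    fix f assume f: "f \<in> K"
    have "f x \<in> {- b x..b x}" if x: "x < n" for x
    proof -
      have "d x * f x * f x \<le> ?ip f f"
        unfolding weighted_inner_def using x d
        by (intro member_le_sum) (auto simp: mult.assoc intro!: mult_nonneg_nonneg[OF less_imp_le zero_le_square])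
      then have "d x * (f x)\<^sup>2 \<le> 1" using f by (simp add: K_def power2_eq_square mult.assoc)
      then have "(f x)\<^sup>2 \<le> 1 / d x" using d[OF x] by (simp add: field_simps)
      then have "sqrt ((f x)\<^sup>2) \<le> sqrt (1 / d x)" by (rule real_sqrt_le_mono)
      then show ?thesis by (auto simp: b_def real_sqrt_divide abs_le_iff)
    qed
    then show "f \<in> B" using f W(2) by (auto simp: B_def K_def PiE_def extensional_def)
  qed
  ultimately have "closed K" unfolding K_def using W(1) by (intro closed_Int)
  then have "compact (B \<inter> K)" using \<open>compact B\<close> by (intro compact_Int_closed)
  then have "compact K" using KB by (simp add: Int_absorb1)
  have normalise: "\<exists>r. r * r > 0 \<and> r * r * ?ip g g = 1 \<and> (\<lambda>x. r * g x) \<in> K"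
    if g: "g \<in> W" "g \<noteq> (\<lambda>_. 0)" for g
  proof -
    define r where "r = 1 / sqrt (?ip g g)"
    have r: "r * r * ?ip g g = 1" "r * r > 0"
      using pos[OF g] by (auto simp: r_def field_simps)
    then have "(\<lambda>x. r * g x) \<in> K"
      using scale[OF g(1)] by (simp add: K_def weighted_inner_scale_left weighted_inner_scale_right mult.assoc)
    with r show ?thesis by blast
  qed
  have "K \<noteq> {}" using normalise[OF h] by blast
  have cT: "continuous_on K (\<lambda>f. T f x)" for x
    unfolding T by (intro continuous_intros continuous_on_subset[OF continuous_on_product_coordinates]) auto
  have "continuous_on K (\<lambda>f. ?ip (T f) f)"
    by (intro continuous_intros cT continuous_on_subset[OF continuous_on_product_coordinates]) auto
  then obtain f where f: "f \<in> K" "\<And>g. g \<in> K \<Longrightarrow> ?ip (T g) g \<le> ?ip (T f) f"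
    using continuous_attains_sup[OF \<open>compact K\<close> \<open>K \<noteq> {}\<close>] by blast
  define M where "M = ?ip (T f) f"
  have fW: "f \<in> W" "?ip f f = 1" using f by (auto simp: K_def)
  have Tlin: "T (\<lambda>x. s * f x + t * g x) = (\<lambda>x. s * T f x + t * T g x)" for f g s t
    by (simp add: T fun_eq_iff sum.distrib sum_distrib_left algebra_simps)
  have Tsc: "T (\<lambda>x. s * f x) = (\<lambda>x. s * T f x)" for f s
    by (simp add: T fun_eq_iff sum_distrib_left algebra_simps)
  have bound: "?ip (T g) g \<le> M * ?ip g g" if g: "g \<in> W" for g
  proof (cases "g = (\<lambda>_. 0)")
    case True
    then show ?thesis by (simp add: weighted_inner_def)
  next
    case False
    obtain r where r: "r * r > 0" "r * r * ?ip g g = 1" "(\<lambda>x. r * g x) \<in> K"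
      using normalise[OF g False] by blast
    have "r * r * ?ip (T g) g \<le> M"
      using f(2)[OF r(3)] unfolding M_def by (simp add: Tsc weighted_inner_scale_left weighted_inner_scale_right mult.assoc)
    also have "M = r * r * (M * ?ip g g)"
      using r by (simp add: algebra_simps)
    finally show ?thesis using r(1) by (simp add: mult_le_cancel_left_pos)
  qed
  \<comment> \<open>The residual at the maximiser \<open>f\<close>. Perturbing \<open>f\<close> in
    this direction inside \<open>W\<close> gives a nonnegative quadratic in \<open>t\<close> with
    linear coefficient \<open>2 * ?ip g g\<close>, so \<open>g\<close> must vanish.\<close>
  define g where "g = (\<lambda>x. M * f x + (- 1) * T f x)"
  have gW: "g \<in> W" unfolding g_def by (rule W(3)[OF fW(1) inv[OF fW(1)]])
  have "0 \<le> (M * ?ip g g - ?ip (T g) g) * t\<^sup>2 + (2 * ?ip g g) * t" for t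
  proof -
    have "0 \<le> M * ?ip (\<lambda>x. 1 * f x + t * g x) (\<lambda>x. 1 * f x + t * g x)
       - ?ip (T (\<lambda>x. 1 * f x + t * g x)) (\<lambda>x. 1 * f x + t * g x)"
      using bound[OF W(3)[OF fW(1) gW, of 1 t]] by simp
    also have "\<dots> = (M * ?ip g g - ?ip (T g) g) * t\<^sup>2 + 2 * (M * ?ip f g - ?ip (T f) g) * t"
    proof -
      have "?ip (T g) f = ?ip (T f) g" "?ip g f = ?ip f g"
        using self[of g f] weighted_inner_commute[of n d] by simp_all
      then show ?thesis
        unfolding Tlin weighted_inner_add_left weighted_inner_add_right
        using fW(2) M_def by (simp add: algebra_simps power2_eq_square)
    qed
    also have "M * ?ip f g - ?ip (T f) g = ?ip g g"
      by (simp add: g_def weighted_inner_def sum_subtractf sum.distrib sum_distrib_left algebra_simps)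
    finally show ?thesis .
  qed
  then have "2 * ?ip g g = 0" by (rule nonneg_quadratic_linear_coeff_0)
  then have "g = (\<lambda>_. 0)" using pos[OF gW] by force
  then have "T f = (\<lambda>x. M * f x)" by (auto simp: g_def fun_eq_iff)
  moreover have "f \<noteq> (\<lambda>_. 0)" using fW(2) by (auto simp: weighted_inner_def)
  ultimately show ?thesis using fW by blast
qed

text \<open>Replaces the spectral theorem. The functions orthogonal to all eigenfunctions of
  \<open>T\<close> form a closed \<open>T\<close>-invariant space, which contains \<open>Q h\<close>
  because \<open>Q\<close> is self-adjoint and kills eigenfunctions. Were \<open>Q h\<close>
  nonzero, this space would contain an eigenfunction, orthogonal to itself.\<close>

lemma selfadjoint_vanishes_if_vanishes_on_eigenfunctions:
  fixes a :: "nat \<Rightarrow> nat \<Rightarrow> real" and d :: "nat \<Rightarrow> real"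
  assumes d: "\<And>x. x < n \<Longrightarrow> d x > 0"
    and T: "\<And>f x. T f x = (\<Sum>y<n. a x y * f y)" "\<And>f x. x \<ge> n \<Longrightarrow> T f x = 0"
    and self: "\<And>f g. weighted_inner n d (T f) g = weighted_inner n d f (T g)"
    and Q: "\<And>f g. weighted_inner n d (Q f) g = weighted_inner n d f (Q g)"
      "\<And>x. x \<ge> n \<Longrightarrow> Q h x = 0"
    and kill: "\<And>f l. f \<noteq> (\<lambda>_. 0) \<Longrightarrow> (\<And>x. x \<ge> n \<Longrightarrow> f x = 0) \<Longrightarrow> T f = (\<lambda>x. l * f x) \<Longrightarrow> Q f = (\<lambda>_. 0)"
  shows "Q h = (\<lambda>_. 0)"
proof (rule ccontr)
  assume ne: "Q h \<noteq> (\<lambda>_. 0)"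
  let ?ip = "weighted_inner n d"
  define G where "G = {g. g \<noteq> (\<lambda>_. 0) \<and> (\<forall>x\<ge>n. g x = 0) \<and> (\<exists>l. T g = (\<lambda>x. l * g x))}"
  define W where "W = (\<Inter>x\<in>{n..}. {f. f x = 0}) \<inter> (\<Inter>g\<in>G. {f. ?ip f g = 0})"
  have "closed W"
    unfolding W_def by (intro closed_Int closed_INT ballI closed_Collect_eq continuous_intros) auto
  moreover have "(\<lambda>x. s * f x + t * g x) \<in> W" if "f \<in> W" "g \<in> W" for f g s t
    using that by (auto simp: W_def weighted_inner_add_left)
  moreover have "T f \<in> W" if "f \<in> W" for f
    using that T(2) by (fastforce simp: W_def self G_def weighted_inner_scale_right)
  moreover have "Q h \<in> W"
  proof -
    have "?ip (Q h) g = 0" if "g \<in> G" for g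
    proof -
      have "Q g = (\<lambda>_. 0)" using that kill unfolding G_def by blast
      then show ?thesis by (simp only: Q(1)) (simp add: weighted_inner_def)
    qed
    then show ?thesis using Q(2) by (auto simp: W_def)
  qed
  moreover have "f x = 0" if "f \<in> W" "x \<ge> n" for f x using that by (auto simp: W_def)
  ultimately have "\<exists>f\<in>W. f \<noteq> (\<lambda>_. 0) \<and> (\<exists>l. T f = (\<lambda>x. l * f x))"
    using ne by (intro exists_eigenfunction_in_subspace[of n d T a W "Q h", OF d T(1) self])
  then obtain f where f: "f \<in> W" "f \<noteq> (\<lambda>_. 0)" "\<exists>l. T f = (\<lambda>x. l * f x)" by blast
  then have "f \<in> G" by (auto simp: G_def W_def)
  then have "?ip f f = 0" using f(1) by (auto simp: W_def)
  then have "f x = 0" for x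
    using weighted_inner_eq_0[of n d f x] d f(1) by (cases "x < n") (auto simp: W_def)
  with f(2) show False by auto
qed

section \<open>The averaging operator of a graph\<close>

locale connected_simple_graph =
  fixes n :: nat and E :: "nat \<Rightarrow> nat \<Rightarrow> bool"
  assumes simple: "simple_graph n E" and connected: "connected_graph n E" and two_le: "n \<ge> 2"
begin

definition nbs :: "nat \<Rightarrow> nat set" where "nbs x = {u. u < n \<and> E x u}"

definition deg :: "nat \<Rightarrow> real" where "deg x = real (graph_degree n E x)"

text \<open>The operator P of the overview: one step of the simple random walk.\<close>

definition avg :: "(nat \<Rightarrow> real) \<Rightarrow> nat \<Rightarrow> real" where "avg f x = (\<Sum>y\<in>nbs x. f y) / deg x"

text \<open>Functions on all naturals stand for vectors of length \<open>n\<close>, hence the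
  support condition. Without it, functions supported on \<open>{n..}\<close> would always make 0 an
  eigenvalue.\<close>

definition walk_eigenvalue :: "real \<Rightarrow> bool" where
  "walk_eigenvalue l \<longleftrightarrow> (\<exists>f. f \<noteq> (\<lambda>_. 0) \<and> (\<forall>x\<ge>n. f x = 0) \<and> avg f = (\<lambda>x. l * f x))"

abbreviation ip :: "(nat \<Rightarrow> real) \<Rightarrow> (nat \<Rightarrow> real) \<Rightarrow> real" where "ip \<equiv> weighted_inner n deg"

text \<open>The entries of \<open>A D^(-1) A\<close>, that is, of P^2 with row \<open>x\<close>
  multiplied by \<open>deg x\<close>.\<close>

definition common_weight :: "nat \<Rightarrow> nat \<Rightarrow> real" where
  "common_weight x y = (\<Sum>z\<in>nbs x \<inter> nbs y. 1 / deg z)"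

lemma E_sym: "E x y \<longleftrightarrow> E y x" and E_irrefl: "\<not> E x x" and E_less: "E x y \<Longrightarrow> x < n \<and> y < n"
  using simple unfolding simple_graph_def by blast+

lemma mem_nbs [simp]: "y \<in> nbs x \<longleftrightarrow> E x y"
  using E_less by (auto simp: nbs_def)

lemma finite_nbs [simp]: "finite (nbs x)"
  by (simp add: nbs_def)

lemma nbs_eq_empty: "x \<ge> n \<Longrightarrow> nbs x = {}"
  using E_less by (fastforce simp: nbs_def)

lemma deg_eq: "deg x = card (nbs x)"
  by (simp add: deg_def graph_degree_def nbs_def)

lemma deg_pos: assumes "x < n" shows "deg x > 0"
proof -
  obtain y where y: "y < n" "y \<noteq> x"
    using two_le that by (metis One_nat_def less_2_cases_iff less_le_trans zero_neq_one)
  then have "(x, y) \<in> {(a, b). E a b}\<^sup>*"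
    using connected assms unfolding connected_graph_def by blast
  then obtain z where "E x z" using y(2) by (auto elim: converse_rtranclE)
  then have "nbs x \<noteq> {}" by (auto simp: mem_nbs[symmetric] simp del: mem_nbs)
  then show ?thesis by (simp add: deg_eq card_gt_0_iff)
qed

lemma avg_outside: "x \<ge> n \<Longrightarrow> avg f x = 0"
  by (simp add: avg_def nbs_eq_empty)

lemma sum_nbs: "(\<Sum>y\<in>nbs x. f y) = (\<Sum>y<n. if E x y then f y else 0)"
  by (subst sum.inter_filter[symmetric]) (auto simp: nbs_def)

lemma avg_matrix: "avg f x = (\<Sum>y<n. (if E x y then 1 / deg x else 0) * f y)"
  unfolding avg_def sum_nbs sum_divide_distrib by (intro sum.cong) auto

lemma ip_avg: "ip (avg f) g = (\<Sum>x<n. \<Sum>y<n. if E x y then f y * g x else 0)"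
proof -
  have "ip (avg f) g = (\<Sum>x<n. (\<Sum>y\<in>nbs x. f y) * g x)"
    unfolding weighted_inner_def by (intro sum.cong) (use deg_pos in \<open>force simp: avg_def\<close>)+
  also have "\<dots> = (\<Sum>x<n. \<Sum>y<n. if E x y then f y * g x else 0)"
    unfolding sum_nbs sum_distrib_right by (intro sum.cong) auto
  finally show ?thesis .
qed

lemma avg_selfadjoint: "ip (avg f) g = ip f (avg g)"
proof -
  have "ip (avg f) g = (\<Sum>y<n. \<Sum>x<n. if E x y then f y * g x else 0)"
    unfolding ip_avg by (rule sum.swap)
  also have "\<dots> = ip (avg g) f"
    unfolding ip_avg by (intro sum.cong) (auto simp: E_sym)
  finally show ?thesis by (simp add: weighted_inner_commute)
qed

lemma avg_lin: "avg (\<lambda>x. s * f x + t * g x) = (\<lambda>x. s * avg f x + t * avg g x)"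
  by (simp add: avg_def fun_eq_iff sum.distrib add_divide_distrib flip: sum_distrib_left)

lemma avg_scale: "avg (\<lambda>x. s * f x) = (\<lambda>x. s * avg f x)"
  by (simp add: avg_def fun_eq_iff flip: sum_distrib_left)

lemma ip_self_edges: "ip f f = (\<Sum>x<n. \<Sum>y<n. if E x y then (f x)\<^sup>2 else 0)"
proof -
  have "(\<Sum>y<n. if E x y then (f x)\<^sup>2 else 0) = deg x * f x * f x" for x
    unfolding sum_nbs[symmetric] by (simp add: deg_eq power2_eq_square)
  then show ?thesis by (simp add: weighted_inner_def)
qed

text \<open>Expand the square, using \<open>s^2 = 1\<close> and that each edge is counted in both
  directions. The cases \<open>s = 1\<close> and \<open>s = -1\<close> bound the spectrum and, where
  the form vanishes, relate the two ends of every edge.\<close>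

lemma dirichlet_form:
  assumes "s\<^sup>2 = 1"
  shows "(\<Sum>x<n. \<Sum>y<n. if E x y then (f x - s * f y)\<^sup>2 else 0) = 2 * (ip f f - s * ip (avg f) f)"
proof -
  have "(\<Sum>x<n. \<Sum>y<n. if E x y then (f x - s * f y)\<^sup>2 else 0) =
     (\<Sum>x<n. \<Sum>y<n. if E x y then (f x)\<^sup>2 else 0) + (\<Sum>x<n. \<Sum>y<n. if E x y then (f y)\<^sup>2 else 0)
     - 2 * s * (\<Sum>x<n. \<Sum>y<n. if E x y then f y * f x else 0)"
    using assms
    by (simp add: sum_distrib_left flip: sum.distrib sum_subtractf)
      (intro sum.cong, auto simp: power2_diff power_mult_distrib)
  also have "(\<Sum>x<n. \<Sum>y<n. if E x y then (f y)\<^sup>2 else 0) = ip f f"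
    unfolding ip_self_edges by (subst sum.swap) (auto simp: E_sym)
  finally show ?thesis by (simp add: ip_self_edges ip_avg)
qed

lemma walk_eigenvalue_abs_le_1:
  assumes "walk_eigenvalue l"
  shows "\<bar>l\<bar> \<le> 1"
proof -
  obtain f where f: "f \<noteq> (\<lambda>_. 0)" "\<forall>x\<ge>n. f x = 0" "avg f = (\<lambda>x. l * f x)"
    using assms by (auto simp: walk_eigenvalue_def)
  have "ip f f \<noteq> 0"
  proof
    assume "ip f f = 0"
    then have "f x = 0" for x using weighted_inner_eq_0[of n deg f x] deg_pos f(2) by (cases "x < n") auto
    with f(1) show False by auto
  qed
  then have pos: "ip f f > 0" using weighted_inner_nonneg[of n deg f] deg_pos by force
  \<comment> \<open>At an eigenfunction the form is \<open>2 * (1 - s * l) * ip f f\<close>; the two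
    signs bound \<open>l\<close> from above and from below.\<close>
  have "0 \<le> (1 - s * l) * ip f f" if s: "s\<^sup>2 = 1" for s
  proof -
    have "0 \<le> (\<Sum>x<n. \<Sum>y<n. if E x y then (f x - s * f y)\<^sup>2 else 0)"
      by (intro sum_nonneg) auto
    then show ?thesis
      unfolding dirichlet_form[OF s] f(3) weighted_inner_scale_left by (simp add: algebra_simps)
  qed
  from this[of 1] this[of "-1"] pos show ?thesis
    by (auto simp: zero_le_mult_iff abs_le_iff)
qed

text \<open>The Dirichlet form vanishes at \<open>h\<close> since \<open>s^2 = 1\<close>, hence so
  does each of its nonnegative summands.\<close>

lemma avg_eq_signed_edges:
  assumes "s\<^sup>2 = 1" "avg h = (\<lambda>x. s * h x)" "E x y"
  shows "h x = s * h y"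
proof -
  have s: "s * s = 1" using assms(1) by (simp add: power2_eq_square)
  have "(\<Sum>x<n. \<Sum>y<n. if E x y then (h x - s * h y)\<^sup>2 else 0) = 0"
    unfolding dirichlet_form[OF assms(1)] assms(2) weighted_inner_scale_left
    using s by (simp flip: mult.assoc)
  then have "\<forall>x<n. (\<Sum>y<n. if E x y then (h x - s * h y)\<^sup>2 else 0) = 0"
    by (subst (asm) sum_nonneg_eq_0_iff) (auto intro!: sum_nonneg)
  then have "\<forall>x<n. \<forall>y<n. (if E x y then (h x - s * h y)\<^sup>2 else 0) = 0"
    by (subst (asm) sum_nonneg_eq_0_iff) auto
  then show ?thesis using assms(3) E_less by fastforce
qed

lemma constant_if_constant_on_edges:
  fixes h :: "nat \<Rightarrow> real"
  assumes "\<And>x y. E x y \<Longrightarrow> h x = h y" "x < n" "y < n"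
  shows "h x = h y"
proof -
  have "(x, y) \<in> {(a, b). E a b}\<^sup>*" using connected assms(2,3) unfolding connected_graph_def by blast
  then show ?thesis by (induction rule: rtrancl_induct) (use assms(1) in auto)
qed

lemma common_weight_commute: "common_weight x y = common_weight y x"
  by (simp add: common_weight_def Int_commute)

lemma avg_avg:
  assumes "x < n"
  shows "avg (avg f) x = (\<Sum>y<n. common_weight x y * f y) / deg x"
proof -
  have "(\<Sum>z\<in>nbs x. avg f z) = (\<Sum>z\<in>nbs x. \<Sum>y<n. if E z y then f y / deg z else 0)"
    unfolding avg_def sum_nbs[of f] sum_divide_distrib by (intro sum.cong) auto
  also have "\<dots> = (\<Sum>y<n. \<Sum>z\<in>nbs x. if E z y then f y / deg z else 0)"
    by (rule sum.swap)
  also have "\<dots> = (\<Sum>y<n. common_weight x y * f y)"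
  proof (intro sum.cong refl)
    fix y
    have "(\<Sum>z\<in>nbs x. if E z y then f y / deg z else 0) = (\<Sum>z\<in>{z \<in> nbs x. E z y}. f y / deg z)"
      by (subst sum.inter_filter) auto
    also have "{z \<in> nbs x. E z y} = nbs x \<inter> nbs y" by (auto simp: E_sym)
    finally show "(\<Sum>z\<in>nbs x. if E z y then f y / deg z else 0) = common_weight x y * f y"
      by (simp add: common_weight_def sum_distrib_right)
  qed
  finally show ?thesis by (simp add: avg_def[of "avg f"])
qed

end

section \<open>Eigenvalues of the normalized Laplacian and of the averaging operator\<close>

context connected_simple_graph
begin

lemma eigenvalue_norm_laplacian_iff:
  "eigenvalue (norm_laplacian n E) \<mu> \<longleftrightarrow> walk_eigenvalue (1 - \<mu>)"
proof -
  let ?L = "norm_laplacian n E"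
  have sq: "sqrt (deg x) * sqrt (deg x) = deg x" for x by (simp add: deg_def)
  have nz: "sqrt (deg x) \<noteq> 0" if "x < n" for x using deg_pos[OF that] by simp
  have dim: "dim_row ?L = n" "dim_col ?L = n" by (simp_all add: norm_laplacian_def)
  have mult: "(?L *\<^sub>v v) $ x = v $ x - (\<Sum>y\<in>nbs x. v $ y / (sqrt (deg x) * sqrt (deg y)))"
    if v: "v \<in> carrier_vec n" and x: "x < n" for v x
  proof -
    have "(?L *\<^sub>v v) $ x = (\<Sum>y<n. ((if x = y then 1 else 0)
        - (if E x y then 1 / sqrt (deg x * deg y) else 0)) * v $ y)"
      using v x by (auto simp: norm_laplacian_def scalar_prod_def deg_def atLeast0LessThan intro!: sum.cong)
    also have "\<dots> = (\<Sum>y<n. (if y = x then v $ x else 0) - (if E x y then v $ y / (sqrt (deg x) * sqrt (deg y)) else 0))"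
      by (intro sum.cong) (auto simp: algebra_simps real_sqrt_mult)
    also have "\<dots> = v $ x - (\<Sum>y\<in>nbs x. v $ y / (sqrt (deg x) * sqrt (deg y)))"
      using x by (simp add: sum_subtractf sum_nbs)
    finally show ?thesis .
  qed
  \<comment> \<open>The substitution \<open>v = D^(1/2) f\<close>: at each vertex the defect of the
    eigenvector equation is that of the equation for \<open>avg\<close>, up to a factor
    \<open>sqrt (deg x)\<close>, which is nonzero, and a sign.\<close>
  have key: "(?L *\<^sub>v v = \<mu> \<cdot>\<^sub>v v) \<longleftrightarrow> (\<forall>x<n. avg f x = (1 - \<mu>) * f x)"
    if v: "v \<in> carrier_vec n" and f: "\<And>x. x < n \<Longrightarrow> v $ x = sqrt (deg x) * f x" for v f
  proof -
    have "(?L *\<^sub>v v = \<mu> \<cdot>\<^sub>v v) \<longleftrightarrow> (\<forall>x<n. (?L *\<^sub>v v) $ x = \<mu> * v $ x)"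
      using v dim by (auto simp: vec_eq_iff)
    also have "\<dots> \<longleftrightarrow> (\<forall>x<n. avg f x = (1 - \<mu>) * f x)"
    proof (intro all_cong)
      fix x assume x: "x < n"
      have "(\<Sum>y\<in>nbs x. v $ y / (sqrt (deg x) * sqrt (deg y))) = (\<Sum>y\<in>nbs x. f y / sqrt (deg x))"
        by (intro sum.cong) (use f nz E_less in auto)
      also have "\<dots> = sqrt (deg x) * avg f x"
        using nz[OF x] sq[of x] by (simp add: avg_def field_simps flip: sum_divide_distrib)
      finally have s: "(?L *\<^sub>v v) $ x = sqrt (deg x) * f x - sqrt (deg x) * avg f x"
        using mult[OF v x] f[OF x] by simp
      have "(?L *\<^sub>v v) $ x - \<mu> * v $ x = sqrt (deg x) * ((1 - \<mu>) * f x - avg f x)"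
        unfolding s f[OF x] by (simp add: algebra_simps)
      then show "(?L *\<^sub>v v) $ x = \<mu> * v $ x \<longleftrightarrow> avg f x = (1 - \<mu>) * f x"
        using nz[OF x] by (metis eq_iff_diff_eq_0 mult_eq_0_iff)
    qed
    finally show ?thesis .
  qed
  show ?thesis
  proof
    assume "eigenvalue ?L \<mu>"
    then obtain v where v: "v \<in> carrier_vec n" "v \<noteq> 0\<^sub>v n" "?L *\<^sub>v v = \<mu> \<cdot>\<^sub>v v"
      by (auto simp: eigenvalue_def eigenvector_def dim)
    define f where "f x = (if x < n then v $ x / sqrt (deg x) else 0)" for x
    have vf: "v $ x = sqrt (deg x) * f x" if "x < n" for x using nz[OF that] that by (simp add: f_def)
    have "avg f x = (1 - \<mu>) * f x" for x
      using key[of v f, OF v(1) vf] v(3) avg_outside[of x f] f_def[of x] by (cases "x < n") auto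
    moreover obtain x where "x < n" "v $ x \<noteq> 0" using v(1,2) by (auto simp: vec_eq_iff)
    then have "f \<noteq> (\<lambda>_. 0)" using vf by fastforce
    ultimately show "walk_eigenvalue (1 - \<mu>)"
      unfolding walk_eigenvalue_def by (intro exI[of _ f]) (auto simp: f_def)
  next
    assume "walk_eigenvalue (1 - \<mu>)"
    then obtain f where f: "f \<noteq> (\<lambda>_. 0)" "\<forall>x\<ge>n. f x = 0" "avg f = (\<lambda>x. (1 - \<mu>) * f x)"
      by (auto simp: walk_eigenvalue_def)
    define v where "v = vec n (\<lambda>x. sqrt (deg x) * f x)"
    have Lv: "?L *\<^sub>v v = \<mu> \<cdot>\<^sub>v v" using key[of v f] f(3) by (simp add: v_def)
    obtain x where "f x \<noteq> 0" using f(1) by auto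
    moreover from this have x: "x < n" using f(2) leI by blast
    ultimately have "v $ x \<noteq> 0" using nz[OF x] by (simp add: v_def)
    then have "v \<noteq> 0\<^sub>v n" using x by auto
    with Lv show "eigenvalue ?L \<mu>"
      unfolding eigenvalue_def eigenvector_def dim by (intro exI[of _ v]) (simp add: v_def)
  qed
qed

lemma card_nlap_eigenvalues: "card (nlap_eigenvalues n E) = card {l. walk_eigenvalue l}"
proof -
  have "nlap_eigenvalues n E = (\<lambda>l. 1 - l) ` {l. walk_eigenvalue l}"
  proof (intro equalityI subsetI)
    fix \<mu> assume "\<mu> \<in> nlap_eigenvalues n E"
    then have "walk_eigenvalue (1 - \<mu>)" by (simp add: nlap_eigenvalues_def eigenvalue_norm_laplacian_iff)
    then show "\<mu> \<in> (\<lambda>l. 1 - l) ` {l. walk_eigenvalue l}"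
      by (intro image_eqI[of _ _ "1 - \<mu>"]) auto
  qed (auto simp: nlap_eigenvalues_def eigenvalue_norm_laplacian_iff)
  then show ?thesis by (simp add: card_image inj_on_def)
qed

end

section \<open>Connected bipartite graphs with four eigenvalues\<close>

text \<open>Negation permutes the two elements other than 1 and -1. It cannot fix one of them: that
  one would be 0, and then so would the other.\<close>

lemma symmetric_card_4:
  fixes S :: "real set"
  assumes S: "card S = 4" "1 \<in> S" "\<And>l. l \<in> S \<Longrightarrow> - l \<in> S" "\<And>l. l \<in> S \<Longrightarrow> \<bar>l\<bar> \<le> 1"
  shows "\<exists>t. 0 < t \<and> t < 1 \<and> S = {1, -1, t, -t}"
proof -
  have m1: "-1 \<in> S" using S(2,3) by blast
  have "finite S" using S(1) card.infinite by force
  then have "card (S - {1, -1}) = 2" using S(1,2) m1 by (subst card_Diff_subset) auto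
  then obtain a b where ab: "S - {1, -1} = {a, b}" "a \<noteq> b" by (auto simp: card_2_iff)
  have neg: "- l \<in> {a, b}" if "l \<in> {a, b}" for l
  proof -
    have "l \<in> S - {1, -1}" using that ab(1) by simp
    then have "- l \<in> S - {1, -1}" using S(3) by auto
    then show ?thesis using ab(1) by simp
  qed
  have b: "b = - a" "a \<noteq> 0" using neg[of a] neg[of b] ab(2) by auto
  have SS: "S = {1, -1, a, - a}" using ab(1) S(2) m1 b by auto
  have "a \<in> S - {1, -1}" using ab(1) by simp
  then have "a \<noteq> 1" "a \<noteq> -1" "\<bar>a\<bar> \<le> 1" using S(4) by auto
  then have "0 < \<bar>a\<bar>" "\<bar>a\<bar> < 1" using b by auto
  moreover have "S = {1, -1, \<bar>a\<bar>, - \<bar>a\<bar>}" using SS by (auto simp: abs_if)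
  ultimately show ?thesis by blast
qed

locale connected_bipartite_graph = connected_simple_graph +
  fixes X :: "nat set"
  assumes X_subset: "X \<subseteq> {..<n}" and E_cross: "E x y \<Longrightarrow> x \<in> X \<longleftrightarrow> y \<notin> X"
begin

text \<open>The parts are interchangeable: interpreting the locale at the other part carries every
  result about \<open>X\<close> over to it.\<close>

lemma flip: "connected_bipartite_graph n E ({..<n} - X)"
  by unfold_locales (use E_cross E_less in auto)

abbreviation part_ind :: "nat \<Rightarrow> real" where "part_ind x \<equiv> of_bool (x \<in> X)"

definition side_sign :: "nat \<Rightarrow> real" where "side_sign x = (if x \<in> X then 1 else -1)"

text \<open>Neighbours lie in opposite parts, so multiplication by the sign anticommutes with
  \<open>avg\<close>; this makes the spectrum symmetric about 0.\<close>

lemma avg_side_sign: "avg (\<lambda>x. side_sign x * f x) = (\<lambda>x. - side_sign x * avg f x)"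
proof
  fix x
  have "(\<Sum>y\<in>nbs x. side_sign y * f y) = (\<Sum>y\<in>nbs x. - side_sign x * f y)"
    by (intro sum.cong) (auto simp: side_sign_def dest: E_cross)
  then show "avg (\<lambda>x. side_sign x * f x) x = - side_sign x * avg f x"
    by (simp add: avg_def sum_negf flip: sum_distrib_left)
qed

lemma walk_eigenvalue_uminus:
  assumes "walk_eigenvalue l"
  shows "walk_eigenvalue (- l)"
proof -
  obtain f where f: "f \<noteq> (\<lambda>_. 0)" "\<forall>x\<ge>n. f x = 0" "avg f = (\<lambda>x. l * f x)"
    using assms by (auto simp: walk_eigenvalue_def)
  have "(\<lambda>x. side_sign x * f x) \<noteq> (\<lambda>_. 0)"
    using f(1) by (auto simp: fun_eq_iff side_sign_def)
  moreover have "avg (\<lambda>x. side_sign x * f x) = (\<lambda>x. - l * (side_sign x * f x))"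
    unfolding avg_side_sign f(3) by (simp add: mult_ac)
  ultimately show ?thesis
    unfolding walk_eigenvalue_def using f(2)
    by (intro exI[of _ "\<lambda>x. side_sign x * f x"]) simp
qed

lemma walk_eigenvalue_1: "walk_eigenvalue 1"
proof -
  have "avg (\<lambda>x. of_bool (x < n)) x = of_bool (x < n)" for x
  proof (cases "x < n")
    case True
    have "(\<Sum>y\<in>nbs x. of_bool (y < n)) = deg x"
      unfolding deg_eq by (subst sum.cong[where h = "\<lambda>_. 1"]) (use E_less in auto)
    then show ?thesis using deg_pos[OF True] True by (simp add: avg_def)
  qed (simp add: avg_outside)
  then show ?thesis
    unfolding walk_eigenvalue_def using two_le
    by (intro exI[of _ "\<lambda>x. of_bool (x < n)"]) (auto simp: fun_eq_iff intro!: exI[of _ 0])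
qed

text \<open>\<open>h + avg h\<close> is fixed by \<open>avg\<close>, and \<open>h - avg h\<close>
  becomes fixed once multiplied by the sign of the part. By connectedness both resulting functions
  are constant on the vertices, and together they determine \<open>h\<close>.\<close>

lemma avg_avg_fixed:
  assumes "avg (avg h) = h"
  shows "\<exists>\<alpha> \<beta>. \<forall>x<n. h x = (if x \<in> X then \<alpha> else \<beta>)"
proof -
  define u v where "u x = h x + avg h x" and "v x = side_sign x * (h x - avg h x)" for x
  have "avg u = (\<lambda>x. 1 * u x)"
    using avg_lin[of 1 h 1 "avg h"] assms by (simp add: u_def[abs_def] add.commute)
  then have "u x = 1 * u y" if "E x y" for x y using avg_eq_signed_edges[of 1 u x y] that by simp
  then have u: "u x = u 0" if "x < n" for x
    using constant_if_constant_on_edges[of u x 0] that two_le by simp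
  have "avg (\<lambda>x. h x - avg h x) = (\<lambda>x. avg h x - h x)"
    using avg_lin[of 1 h "-1" "avg h"] assms by simp
  then have "avg v = (\<lambda>x. 1 * v x)"
    unfolding v_def[abs_def] avg_side_sign by (auto simp: algebra_simps)
  then have "v x = 1 * v y" if "E x y" for x y using avg_eq_signed_edges[of 1 v x y] that by simp
  then have v: "v x = v 0" if "x < n" for x
    using constant_if_constant_on_edges[of v x 0] that two_le by simp
  have "h x = (u x + side_sign x * v x) / 2" for x
    by (simp add: u_def v_def side_sign_def)
  then have "\<forall>x<n. h x = (if x \<in> X then (u 0 + v 0) / 2 else (u 0 - v 0) / 2)"
    using u v by (metis add_uminus_conv_diff mult_1 mult_minus1 side_sign_def)
  then show ?thesis by blast
qed

lemma avg_part_ind: "avg part_ind = (\<lambda>x. of_bool (x \<in> {..<n} - X))"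
proof
  fix x
  show "avg part_ind x = of_bool (x \<in> {..<n} - X)"
  proof (cases "x < n")
    case True
    have "(\<Sum>y\<in>nbs x. part_ind y) = (\<Sum>y\<in>nbs x. of_bool (x \<notin> X))"
      by (intro sum.cong) (auto dest: E_cross)
    also have "\<dots> = deg x * of_bool (x \<notin> X)" by (simp add: deg_eq)
    finally show ?thesis using deg_pos[OF True] True unfolding avg_def by simp
  qed (simp add: avg_outside)
qed

lemma avg_coindicator: "avg (\<lambda>x. of_bool (x \<in> {..<n} - X)) = part_ind"
proof -
  interpret Y: connected_bipartite_graph n E "{..<n} - X" by (rule flip)
  have "{..<n} - ({..<n} - X) = X" using X_subset by auto
  then show ?thesis using Y.avg_part_ind by simp
qed

lemma avg_avg_two_values:
  assumes "f = (\<lambda>u. \<alpha> * part_ind u + \<beta> * of_bool (u \<in> {..<n} - X))"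
  shows "avg (avg f) = f"
  unfolding assms avg_lin avg_part_ind avg_coindicator ..

lemma ip_part_ind: "ip f part_ind = (\<Sum>x\<in>X. deg x * f x)"
proof -
  have "ip f part_ind = (\<Sum>x\<in>X. deg x * f x * part_ind x)"
    using X_subset unfolding weighted_inner_def by (intro sum.mono_neutral_right) auto
  then show ?thesis by simp
qed

text \<open>Both sides count the edges; here this is self-adjointness applied to the indicators of
  the parts, which \<open>avg\<close> interchanges.\<close>

lemma sum_deg_parts: "(\<Sum>x\<in>X. deg x) = (\<Sum>x\<in>{..<n} - X. deg x)"
proof -
  interpret Y: connected_bipartite_graph n E "{..<n} - X" by (rule flip)
  have "ip part_ind part_ind = ip (\<lambda>x. of_bool (x \<in> {..<n} - X)) (\<lambda>x. of_bool (x \<in> {..<n} - X))"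
    using avg_selfadjoint[of "\<lambda>x. of_bool (x \<in> {..<n} - X)" part_ind]
    unfolding avg_part_ind avg_coindicator .
  then show ?thesis unfolding ip_part_ind Y.ip_part_ind by simp
qed

lemma avg_poly_vanishes:
  assumes ev: "\<And>l. walk_eigenvalue l \<Longrightarrow> l\<^sup>2 = 1 \<or> l\<^sup>2 = q" and h: "\<And>x. x \<ge> n \<Longrightarrow> h x = 0"
  defines "g \<equiv> \<lambda>x. avg (avg h) x - q * h x"
  shows "avg (avg g) = g"
proof -
  \<comment> \<open>The polynomial (P^2 - 1)(P^2 - \<open>q\<close>) in P. It is self-adjoint and
    kills every eigenfunction of P, so it vanishes on functions supported below
    \<open>n\<close>.\<close>
  define Q where "Q f = (\<lambda>x. avg (avg (avg (avg f))) x - (1 + q) * avg (avg f) x + q * f x)" for f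
  have Q_self: "ip (Q f) g = ip f (Q g)" for f g
  proof -
    have 2: "ip (avg (avg f)) g = ip f (avg (avg g))" for f g by (simp add: avg_selfadjoint)
    have Q': "Q f = (\<lambda>x. 1 * (1 * avg (avg (avg (avg f))) x + (- (1 + q)) * avg (avg f) x) + q * f x)" for f
      by (simp add: Q_def algebra_simps)
    show ?thesis
      unfolding Q' weighted_inner_add_left weighted_inner_add_right by (simp add: 2)
  qed
  have "Q h = (\<lambda>_. 0)"
  proof (rule selfadjoint_vanishes_if_vanishes_on_eigenfunctions[of n deg avg _ Q, OF deg_pos avg_matrix avg_outside avg_selfadjoint Q_self])
    show "Q h x = 0" if "x \<ge> n" for x using that h by (simp add: Q_def avg_outside)
    show "Q f = (\<lambda>_. 0)" if f: "f \<noteq> (\<lambda>_. 0)" "\<And>x. x \<ge> n \<Longrightarrow> f x = 0" "avg f = (\<lambda>x. l * f x)" for f l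
    proof -
      have "walk_eigenvalue l" using f unfolding walk_eigenvalue_def by blast
      then have "l * l = 1 \<or> l * l = q" using ev by (auto simp: power2_eq_square)
      then have l: "(l * l - 1) * (l * l - q) = 0" by auto
      have 2: "avg (avg f) = (\<lambda>x. (l * l) * f x)" by (simp add: f(3) avg_scale mult.assoc)
      have "Q f = (\<lambda>x. ((l * l - 1) * (l * l - q)) * f x)"
        unfolding Q_def by (simp only: 2 avg_scale) (simp add: algebra_simps)
      then show ?thesis by (simp only: l) simp
    qed
  qed
  then have Q0: "Q h x = 0" for x by simp
  have g': "g = (\<lambda>x. 1 * avg (avg h) x + (- q) * h x)" by (simp add: g_def)
  show "avg (avg g) = g"
  proof
    fix x
    show "avg (avg g) x = g x"
      using Q0[of x] unfolding g' avg_lin by (simp add: Q_def algebra_simps)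
  qed
qed

text \<open>Apply P^2 - \<open>q\<close> to the point mass at \<open>x\<close>. The result is
  constant on \<open>X\<close>; pairing it with the indicator of \<open>X\<close>, which P^2
  preserves, determines the constant, and its value at \<open>y\<close> gives the required entry of
  P^2.\<close>

lemma common_weight_eq:
  assumes ev: "\<And>l. walk_eigenvalue l \<Longrightarrow> l\<^sup>2 = 1 \<or> l\<^sup>2 = q" and xy: "x \<in> X" "y \<in> X"
  shows "common_weight x y = (if x = y then q * deg x else 0) + (1 - q) / (\<Sum>u\<in>X. deg u) * deg x * deg y"
proof -
  define h :: "nat \<Rightarrow> real" where "h u = of_bool (u = x)" for u
  define g where "g u = avg (avg h) u - q * h u" for u
  have n: "x < n" "y < n" using xy X_subset by auto
  have h: "h u = 0" if "u \<ge> n" for u using that n by (auto simp: h_def)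
  have "avg (avg g) = g"
    unfolding g_def[abs_def] by (rule avg_poly_vanishes[OF ev h])
  then obtain \<alpha> \<beta> where \<alpha>: "\<forall>u<n. g u = (if u \<in> X then \<alpha> else \<beta>)" using avg_avg_fixed by blast
  then have gX: "g u = \<alpha>" if "u \<in> X" for u using that X_subset by auto
  have "ip (avg (avg h)) part_ind = ip h part_ind"
    by (simp add: avg_selfadjoint avg_part_ind avg_coindicator del: Diff_iff)
  then have "(\<Sum>u\<in>X. deg u * avg (avg h) u) = (\<Sum>u\<in>X. deg u * h u)"
    unfolding ip_part_ind .
  moreover have fX: "finite X" using X_subset finite_subset by blast
  have "(\<Sum>u\<in>X. deg u * h u) = deg x"
    using fX xy by (simp add: h_def of_bool_def if_distrib cong: if_cong)
  moreover have "(\<Sum>u\<in>X. deg u * avg (avg h) u) = (\<Sum>u\<in>X. q * (deg u * h u) + \<alpha> * deg u)"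
    using gX by (intro sum.cong) (auto simp: g_def algebra_simps simp flip: gX)
  ultimately have e: "deg x = q * deg x + \<alpha> * (\<Sum>u\<in>X. deg u)"
    by (simp add: sum.distrib flip: sum_distrib_left)
  have pos: "(\<Sum>u\<in>X. deg u) > 0"
    using xy fX X_subset deg_pos by (intro sum_pos) auto
  have \<alpha>eq: "\<alpha> = (1 - q) / (\<Sum>u\<in>X. deg u) * deg x"
    using e pos by (simp add: field_simps)
  have "avg (avg h) y = common_weight y x / deg y"
    unfolding avg_avg[OF n(2)] using n by (simp add: h_def of_bool_def if_distrib cong: if_cong)
  then have "common_weight x y = deg y * avg (avg h) y"
    using deg_pos[OF n(2)] by (simp add: common_weight_commute[of x])
  also have "\<dots> = deg y * (q * h y + \<alpha>)" using gX[OF xy(2)] by (simp add: g_def)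
  finally show ?thesis unfolding \<alpha>eq by (auto simp: h_def algebra_simps)
qed

text \<open>Both sides sum \<open>1 / (deg x * deg y)\<close> over the edges; they are the traces of
  P^2 on the two parts.\<close>

lemma trace_part:
  "(\<Sum>x\<in>X. common_weight x x / deg x) = (\<Sum>x\<in>{..<n} - X. common_weight x x / deg x)"
proof -
  have *: "common_weight x x / deg x = (\<Sum>y<n. if E x y then 1 / (deg x * deg y) else 0)" for x
    unfolding common_weight_def by (simp add: sum_nbs sum_divide_distrib) (auto intro!: sum.cong simp: mult.commute)
  have "(\<Sum>x\<in>X. common_weight x x / deg x) = (\<Sum>x\<in>X. \<Sum>y\<in>{..<n} - X. if E x y then 1 / (deg x * deg y) else 0)"
    unfolding * by (intro sum.cong refl sum.mono_neutral_right) (auto dest: E_cross)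
  also have "\<dots> = (\<Sum>y\<in>{..<n} - X. \<Sum>x\<in>X. if E x y then 1 / (deg x * deg y) else 0)"
    by (rule sum.swap)
  also have "\<dots> = (\<Sum>x\<in>{..<n} - X. common_weight x x / deg x)"
    unfolding * by (intro sum.cong refl sum.mono_neutral_cong_left)
      (use X_subset in \<open>auto simp: E_sym mult.commute dest: E_cross\<close>)
  finally show ?thesis .
qed

text \<open>On each part P^2 is \<open>q\<close> times the identity plus a rank-one matrix, with the
  same constants on both parts.\<close>

definition walk_identity :: "real \<Rightarrow> real \<Rightarrow> bool" where
  "walk_identity q c \<longleftrightarrow> (\<forall>x<n. \<forall>y<n. (x \<in> X \<longleftrightarrow> y \<in> X) \<longrightarrow>
     common_weight x y = (if x = y then q * deg x else 0) + c * deg x * deg y)"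

lemma parts_nonempty: "X \<noteq> {}" "{..<n} - X \<noteq> {}"
proof -
  have "deg 0 > 0" using deg_pos two_le by simp
  then have "nbs 0 \<noteq> {}" by (auto simp: deg_eq)
  then obtain y where "E 0 y" by (metis ex_in_conv mem_nbs)
  then show "X \<noteq> {}" "{..<n} - X \<noteq> {}" using E_cross[of 0 y] E_less[of 0 y] by auto
qed

lemma walk_identity_if_four_eigenvalues:
  assumes "card {l. walk_eigenvalue l} = 4"
  shows "\<exists>q c. 0 < q \<and> q < 1 \<and> 0 < c \<and> walk_identity q c \<and> card X = card ({..<n} - X) \<and> card X \<ge> 2"
proof -
  interpret Y: connected_bipartite_graph n E "{..<n} - X" by (rule flip)
  obtain t where t: "0 < t" "t < 1" "{l. walk_eigenvalue l} = {1, -1, t, -t}"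
    using symmetric_card_4[of "{l. walk_eigenvalue l}"] assms walk_eigenvalue_1
      walk_eigenvalue_uminus walk_eigenvalue_abs_le_1 by auto
  define q where "q = t\<^sup>2"
  have q: "0 < q" "q < 1" using t by (auto simp: q_def power_less_one_iff)
  have "l \<in> {1, -1, t, -t}" if "walk_eigenvalue l" for l using that t(3) by blast
  then have ev: "l\<^sup>2 = 1 \<or> l\<^sup>2 = q" if "walk_eigenvalue l" for l using that by (force simp: q_def)
  \<comment> \<open>The number of edges. It is the degree sum of either part, so a single constant
    \<open>c\<close> serves both.\<close>
  define e where "e = (\<Sum>u\<in>X. deg u)"
  have eY: "e = (\<Sum>u\<in>{..<n} - X. deg u)" by (simp add: e_def sum_deg_parts)
  have fX: "finite X" using X_subset finite_subset by blast
  have e: "e > 0" unfolding e_def using parts_nonempty fX X_subset deg_pos by (intro sum_pos) auto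
  define c where "c = (1 - q) / e"
  have c: "c > 0" using e q by (simp add: c_def)
  have wX: "common_weight x y = (if x = y then q * deg x else 0) + c * deg x * deg y" if "x \<in> X" "y \<in> X" for x y
    unfolding c_def e_def by (rule common_weight_eq[OF ev that])
  have wY: "common_weight x y = (if x = y then q * deg x else 0) + c * deg x * deg y"
    if "x \<in> {..<n} - X" "y \<in> {..<n} - X" for x y
    unfolding c_def eY by (rule Y.common_weight_eq[OF ev that])
  have "walk_identity q c"
    unfolding walk_identity_def using wX wY by blast
  moreover have card: "card X = card ({..<n} - X)"
  proof -
    \<comment> \<open>The trace of P^2 on a part is \<open>q\<close> times its size plus
      \<open>c * e\<close>; equal traces and \<open>q > 0\<close> give equal sizes.\<close>
    have div: "(q * deg x + c * deg x * deg x) / deg x = q + c * deg x" if "x < n" for x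
      using deg_pos[OF that] by (simp add: field_simps)
    have "(\<Sum>x\<in>X. common_weight x x / deg x) = (\<Sum>x\<in>X. q + c * deg x)"
      by (intro sum.cong refl, subst wX) (use div X_subset in auto)
    moreover have "(\<Sum>x\<in>{..<n} - X. common_weight x x / deg x) = (\<Sum>x\<in>{..<n} - X. q + c * deg x)"
      by (intro sum.cong refl, subst wY) (use div in auto)
    ultimately have "q * real (card X) + c * e = q * real (card ({..<n} - X)) + c * e"
      using trace_part by (simp add: sum.distrib e_def[symmetric] eY[symmetric] mult.commute flip: sum_distrib_left) metis
    then show ?thesis using q by simp
  qed
  \<comment> \<open>With one vertex in each part every function on the vertices is constant on parts
    and hence fixed by P^2, which contradicts \<open>t * t = q < 1\<close>.\<close>
  moreover have "card X \<ge> 2"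
  proof (rule ccontr)
    assume "\<not> card X \<ge> 2"
    moreover have "card X \<noteq> 0" using parts_nonempty fX by simp
    ultimately have "card X = 1" by linarith
    with card obtain x y where xy: "X = {x}" "{..<n} - X = {y}" by (metis card_1_singletonE)
    have "walk_eigenvalue t" using t(3) by blast
    then obtain f where f: "f \<noteq> (\<lambda>_. 0)" "\<forall>x\<ge>n. f x = 0" "avg f = (\<lambda>x. t * f x)"
      by (auto simp: walk_eigenvalue_def)
    have "f = (\<lambda>u. f x * part_ind u + f y * of_bool (u \<in> {..<n} - X))"
    proof
      fix u
      consider "u \<in> X" "u < n" | "u \<in> {..<n} - X" | "u \<ge> n" "u \<notin> X" using X_subset by fastforce
      then show "f u = f x * part_ind u + f y * of_bool (u \<in> {..<n} - X)"
        by cases (use xy f(2) in auto)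
    qed
    then have "avg (avg f) = f" by (rule avg_avg_two_values)
    then have "f = (\<lambda>x. (t * t) * f x)" by (simp add: f(3) avg_scale mult.assoc)
    moreover obtain u where "f u \<noteq> 0" using f(1) by auto
    ultimately have "t * t = 1" by (metis mult_cancel_right1)
    then show False using q by (simp add: q_def power2_eq_square)
  qed
  ultimately show ?thesis using q c by blast
qed

lemma avg_avg_if_walk_identity:
  assumes "walk_identity q c" "x \<in> X"
  shows "avg (avg f) x = q * f x + c * (\<Sum>y\<in>X. deg y * f y)"
proof -
  have x: "x < n" using assms X_subset by auto
  have fX: "finite X" using X_subset finite_subset by blast
  have "common_weight x y = 0" if "y \<notin> X" for y
  proof -
    have "nbs x \<inter> nbs y = {}" using assms(2) that E_cross by (auto; blast)
    then show ?thesis by (simp add: common_weight_def)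
  qed
  then have "(\<Sum>y<n. common_weight x y * f y) = (\<Sum>y\<in>X. common_weight x y * f y)"
    using X_subset by (intro sum.mono_neutral_right) auto
  also have "\<dots> = (\<Sum>y\<in>X. (if y = x then q * deg x * f x else 0) + c * deg x * (deg y * f y))"
    using assms X_subset x unfolding walk_identity_def by (intro sum.cong) (auto simp: algebra_simps)
  also have "\<dots> = q * deg x * f x + c * deg x * (\<Sum>y\<in>X. deg y * f y)"
    using fX assms(2) by (simp add: sum.distrib flip: sum_distrib_left)
  finally show ?thesis
    unfolding avg_avg[OF x] using deg_pos[OF x] by (simp add: field_simps)
qed

text \<open>On each part P^2 is \<open>q\<close> plus a map into the constants. So an eigenfunction
  whose eigenvalue has square different from \<open>q\<close> is constant on each part, which forces
  the square to be 1. For the square roots of \<open>q\<close> an eigenfunction is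
  exhibited.\<close>

lemma four_eigenvalues_if_walk_identity:
  assumes w: "walk_identity q c" and q: "0 < q" "q < 1" and X: "card X \<ge> 2"
  shows "card {l. walk_eigenvalue l} = 4"
proof -
  interpret Y: connected_bipartite_graph n E "{..<n} - X" by (rule flip)
  have wY: "Y.walk_identity q c" using w unfolding walk_identity_def Y.walk_identity_def by auto
  define t where "t = sqrt q"
  have t: "0 < t" "t < 1" "t * t = q" using q by (auto simp: t_def)
  have fX: "finite X" using X_subset finite_subset by blast
  have "l \<in> {1, -1, t, -t}" if ev: "walk_eigenvalue l" for l
  proof (cases "l * l = q")
    case True
    then have "(l - t) * (l + t) = 0" using t by (simp add: algebra_simps)
    then show ?thesis by auto
  next
    case False
    obtain f where f: "f \<noteq> (\<lambda>_. 0)" "\<forall>x\<ge>n. f x = 0" "avg f = (\<lambda>x. l * f x)"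
      using ev by (auto simp: walk_eigenvalue_def)
    have 2: "avg (avg f) x = l * l * f x" for x by (simp add: f(3) avg_scale mult.assoc)
    define \<alpha> \<beta> where "\<alpha> = c * (\<Sum>y\<in>X. deg y * f y) / (l * l - q)"
      and "\<beta> = c * (\<Sum>y\<in>{..<n} - X. deg y * f y) / (l * l - q)"
    have "f x = \<alpha>" if "x \<in> X" for x
      using avg_avg_if_walk_identity[OF w that, of f] False by (simp add: 2 \<alpha>_def field_simps)
    moreover have "f x = \<beta>" if "x \<in> {..<n} - X" for x
      using Y.avg_avg_if_walk_identity[OF wY that, of f] False by (simp add: 2 \<beta>_def field_simps)
    moreover have "u \<in> X \<and> u < n \<or> u \<in> {..<n} - X \<or> u \<ge> n \<and> u \<notin> X" for u using X_subset by auto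
    ultimately have "f u = \<alpha> * part_ind u + \<beta> * of_bool (u \<in> {..<n} - X)" for u
      using f(2) by (smt (verit, best) DiffD2 mult_cancel_left1 mult_cancel_right2 mult_zero_right of_bool_eq(1) of_bool_eq(2) leD lessThan_iff DiffD1)
    then have "f = (\<lambda>u. \<alpha> * part_ind u + \<beta> * of_bool (u \<in> {..<n} - X))" by blast
    then have "avg (avg f) = f" by (rule avg_avg_two_values)
    moreover obtain u where "f u \<noteq> 0" using f(1) by auto
    ultimately have "l * l = 1" using 2[of u] by simp
    then have "(l - 1) * (l + 1) = 0" by (simp add: algebra_simps)
    then show ?thesis by auto
  qed
  moreover have "walk_eigenvalue t"
  proof -
    obtain x y where xy: "x \<in> X" "y \<in> X" "x \<noteq> y"
      using X by (metis One_nat_def Suc_1 card_le_Suc0_iff_eq fX not_less_eq_eq)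
    have n: "x < n" "y < n" using xy X_subset by auto
    \<comment> \<open>Supported on two vertices of \<open>X\<close> with degree-weighted sum 0, so
      that the constant term of P^2 disappears.\<close>
    define g where "g u = (if u = x then deg y else if u = y then - deg x else 0)" for u
    have g0: "g u = 0" if "u \<notin> X" for u using that xy by (auto simp: g_def)
    have "(\<Sum>u\<in>X. deg u * g u) = (\<Sum>u\<in>{x, y}. deg u * g u)"
      using fX xy by (intro sum.mono_neutral_right) (auto simp: g_def)
    then have "(\<Sum>u\<in>X. deg u * g u) = 0" using xy by (simp add: g_def)
    then have gX: "avg (avg g) u = q * g u" if "u \<in> X" for u
      using avg_avg_if_walk_identity[OF w that, of g] by simp
    have gY: "avg (avg g) u = q * g u" if "u \<in> {..<n} - X" for u
    proof -
      have "(\<Sum>y\<in>{..<n} - X. deg y * g y) = 0" using g0 by (intro sum.neutral) auto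
      then show ?thesis using Y.avg_avg_if_walk_identity[OF wY that, of g] by simp
    qed
    have g2: "avg (avg g) = (\<lambda>u. q * g u)"
    proof
      fix u
      show "avg (avg g) u = q * g u"
        using gX gY avg_outside[of u "avg g"] g0[of u] X_subset by (cases "u \<in> X"; cases "u < n") auto
    qed
    \<comment> \<open>As (P - \<open>t\<close>)(P + \<open>t\<close>) kills \<open>g\<close>, apply
      P + \<open>t\<close> to it. At \<open>x\<close> the value is \<open>t * deg y\<close>, since
      \<open>avg g\<close> vanishes on \<open>X\<close>.\<close>
    define f where "f u = 1 * avg g u + t * g u" for u
    have "avg f = (\<lambda>u. t * f u)"
      unfolding f_def[abs_def] avg_lin g2 using t(3) by (simp add: fun_eq_iff algebra_simps)
    moreover have "\<forall>u\<ge>n. f u = 0"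
      using X_subset g0 by (fastforce simp: f_def avg_outside)
    moreover have "f x \<noteq> 0"
    proof -
      have "(\<Sum>u\<in>nbs x. g u) = 0" using xy(1) g0 E_cross by (intro sum.neutral) (metis mem_nbs)
      then show ?thesis using t deg_pos[OF n(2)] by (simp add: f_def avg_def g_def)
    qed
    then have "f \<noteq> (\<lambda>_. 0)" by auto
    ultimately show ?thesis unfolding walk_eigenvalue_def by blast
  qed
  ultimately have "{l. walk_eigenvalue l} = {1, -1, t, -t}"
    using walk_eigenvalue_1 walk_eigenvalue_uminus by blast
  then show ?thesis using t by simp
qed

end

section \<open>Incidence structures with block size \<open>s\<close> and pair count \<open>s / 2\<close>\<close>

text \<open>For \<open>s = 1\<close> this is a single edge, for \<open>s = 2 * t\<close> the
  complement of a Hadamard design, so both cases of the theorem are treated at once. The doubled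
  pair count avoids halving \<open>s\<close>.\<close>

definition half_incidence :: "('a \<Rightarrow> 'b \<Rightarrow> bool) \<Rightarrow> 'a set \<Rightarrow> 'b set \<Rightarrow> nat \<Rightarrow> bool" where
  "half_incidence R A B s \<longleftrightarrow> finite A \<and> finite B \<and> s \<ge> 1 \<and> card A = 2 * s - 1 \<and> card B = 2 * s - 1 \<and>
     (\<forall>x\<in>A. card {y \<in> B. R x y} = s) \<and> (\<forall>y\<in>B. card {x \<in> A. R x y} = s) \<and>
     (\<forall>x\<in>A. \<forall>x'\<in>A. x \<noteq> x' \<longrightarrow> 2 * card {y \<in> B. R x y \<and> R x' y} = s)"

lemma card_filter_eq_sum: "finite A \<Longrightarrow> real (card {x \<in> A. P x}) = (\<Sum>x\<in>A. of_bool (P x))"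
  by (simp add: Int_def)

text \<open>For a fixed block the intersection sizes with the other blocks have mean \<open>s/2\<close> and, by counting
  pairs of points, variance 0.\<close>
lemma half_incidence_dual:
  assumes "half_incidence R A B s"
  shows "half_incidence (\<lambda>y x. R x y) B A s"
proof -
  have fin: "finite A" "finite B" and s: "s \<ge> 1" and card: "card A = 2 * s - 1" "card B = 2 * s - 1"
    and degA: "\<And>x. x \<in> A \<Longrightarrow> card {y \<in> B. R x y} = s" and degB: "\<And>y. y \<in> B \<Longrightarrow> card {x \<in> A. R x y} = s"
    and pair: "\<And>x x'. x \<in> A \<Longrightarrow> x' \<in> A \<Longrightarrow> x \<noteq> x' \<Longrightarrow> 2 * card {y \<in> B. R x y \<and> R x' y} = s"
    using assms by (auto simp: half_incidence_def)
  have "2 * card {x \<in> A. R x y \<and> R x y'} = s" if y: "y \<in> B" "y' \<in> B" "y \<noteq> y'" for y y'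
  proof -
    define N where "N = {x \<in> A. R x y}"
    have N: "finite N" "card N = s" "N \<subseteq> A" using fin degB[OF y(1)] by (auto simp: N_def)
    define a where "a u = (\<Sum>x\<in>N. of_bool (R x u) :: real)" for u
    have a_card: "a u = real (card {x \<in> A. R x y \<and> R x u})" for u
    proof -
      have "{x \<in> A. R x y \<and> R x u} = {x \<in> N. R x u}" by (auto simp: N_def)
      then show ?thesis using card_filter_eq_sum[OF N(1), of "\<lambda>x. R x u"] by (simp add: a_def)
    qed
    have s1: "(\<Sum>u\<in>B. a u) = s * s"
    proof -
      have "(\<Sum>u\<in>B. a u) = (\<Sum>x\<in>N. \<Sum>u\<in>B. of_bool (R x u))"
        unfolding a_def by (rule sum.swap)
      also have "\<dots> = (\<Sum>x\<in>N. real s)"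
        using N(3) degA by (intro sum.cong) (auto simp: subset_iff simp flip: card_filter_eq_sum[OF fin(2)])
      finally show ?thesis using N by simp
    qed
    \<comment> \<open>Counts ordered pairs of points of \<open>N\<close> together with a block
      containing both: \<open>s\<close> blocks for equal points, \<open>s / 2\<close> for distinct
      ones.\<close>
    have s2: "(\<Sum>u\<in>B. a u * a u) = s * (s + (real s - 1) * (s / 2))"
    proof -
      have "(\<Sum>u\<in>B. a u * a u) = (\<Sum>u\<in>B. \<Sum>x\<in>N. \<Sum>x'\<in>N. of_bool (R x u \<and> R x' u))"
        unfolding a_def sum_product of_bool_conj ..
      also have "\<dots> = (\<Sum>x\<in>N. \<Sum>u\<in>B. \<Sum>x'\<in>N. of_bool (R x u \<and> R x' u))"
        by (rule sum.swap)
      also have "\<dots> = (\<Sum>x\<in>N. \<Sum>x'\<in>N. \<Sum>u\<in>B. of_bool (R x u \<and> R x' u))"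
        by (intro sum.cong refl sum.swap)
      also have "\<dots> = (\<Sum>x\<in>N. s + (real s - 1) * (s / 2))"
      proof (intro sum.cong refl)
        fix x assume x: "x \<in> N"
        have "(\<Sum>x'\<in>N. \<Sum>u\<in>B. of_bool (R x u \<and> R x' u)) =
            (\<Sum>u\<in>B. of_bool (R x u \<and> R x u)) + (\<Sum>x'\<in>N - {x}. \<Sum>u\<in>B. of_bool (R x u \<and> R x' u) :: real)"
          by (rule sum.remove[OF N(1) x])
        also have "(\<Sum>u\<in>B. of_bool (R x u \<and> R x u)) = real s"
          using x N(3) degA by (auto simp: subset_iff simp flip: card_filter_eq_sum[OF fin(2)])
        also have "(\<Sum>x'\<in>N - {x}. \<Sum>u\<in>B. of_bool (R x u \<and> R x' u)) = (\<Sum>x'\<in>N - {x}. real s / 2)"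
        proof (intro sum.cong refl)
          fix x' assume "x' \<in> N - {x}"
          then have "2 * card {u \<in> B. R x u \<and> R x' u} = s" using x N(3) pair[of x x'] by auto
          then have "real (card {u \<in> B. R x u \<and> R x' u}) = real s / 2" by linarith
          then show "(\<Sum>u\<in>B. of_bool (R x u \<and> R x' u)) = real s / 2"
            by (simp only: card_filter_eq_sum[OF fin(2)])
        qed
        also have "\<dots> = (real s - 1) * (s / 2)" using N x s by (simp add: of_nat_diff)
        finally show "(\<Sum>x'\<in>N. \<Sum>u\<in>B. of_bool (R x u \<and> R x' u)) = s + (real s - 1) * (s / 2)" .
      qed
      finally show ?thesis using N by simp
    qed
    have ay: "a y = s" using degB[OF y(1)] by (simp add: a_card)
    have "(\<Sum>u\<in>B. (a u - s / 2)\<^sup>2) = (\<Sum>u\<in>B. a u * a u - s * a u + s * s / 4)"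
      by (intro sum.cong) (auto simp: power2_eq_square algebra_simps)
    also have "\<dots> = (\<Sum>u\<in>B. a u * a u) - s * (\<Sum>u\<in>B. a u) + real (card B) * (s * s / 4)"
      by (simp add: sum.distrib sum_subtractf sum_distrib_left)
    \<comment> \<open>The term for \<open>u = y\<close> alone is \<open>(s - s / 2)^2\<close>,
      already the whole sum, so every other term is 0.\<close>
    also have "\<dots> = (s / 2)\<^sup>2"
      unfolding s1 s2 card using s by (simp add: of_nat_diff power2_eq_square field_simps)
    finally have "(\<Sum>u\<in>B. (a u - s / 2)\<^sup>2) = (a y - s / 2)\<^sup>2" by (simp add: ay)
    then have "(\<Sum>u\<in>B - {y}. (a u - s / 2)\<^sup>2) = 0"
      using sum.remove[OF fin(2) y(1), of "\<lambda>u. (a u - s / 2)\<^sup>2"] by simp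
    then have "\<forall>u\<in>B - {y}. (a u - s / 2)\<^sup>2 = 0"
      using fin by (subst (asm) sum_nonneg_eq_0_iff) auto
    then have "a y' = s / 2" using y by force
    then show ?thesis unfolding a_card by linarith
  qed
  then show ?thesis
    using fin s card degA degB by (auto simp: half_incidence_def)
qed

section \<open>From the walk identity to the described graphs\<close>

context connected_bipartite_graph
begin

text \<open>The pendant vertex \<open>z\<close> forces \<open>w\<close> to be adjacent to all of \<open>X\<close>, since the identity gives
  any two vertices of a part a common neighbour.\<close>
lemma half_incidence_if_walk_identity:
  assumes wi: "walk_identity q c" and c: "0 < c"
    and card_eq: "card X = card ({..<n} - X)" and X2: "card X \<ge> 2"
    and z: "z \<in> X" "graph_degree n E z = 1"
  shows "\<exists>w s. w \<in> {..<n} - X \<and> nbs z = {w} \<and> nbs w = X \<and> half_incidence E (X - {z}) ({..<n} - X - {w}) s"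
proof -
  define Y where "Y = {..<n} - X"
  define m where "m = card X"
  have fX: "finite X" "finite Y" using X_subset finite_subset by (auto simp: Y_def)
  have cw: "common_weight x y = (if x = y then q * deg x else 0) + c * deg x * deg y"
    if "x \<in> X \<and> y \<in> X \<or> x \<in> Y \<and> y \<in> Y" for x y
    using wi that X_subset unfolding walk_identity_def Y_def by blast
  have dpos: "deg x > 0" if "x \<in> X \<or> x \<in> Y" for x using that X_subset deg_pos by (auto simp: Y_def)
  have nY: "nbs x \<subseteq> Y" if "x \<in> X" for x using that E_cross E_less by (auto simp: Y_def)
  have nX: "nbs y \<subseteq> X" if "y \<in> Y" for y using that E_cross by (auto simp: Y_def)
  have "card (nbs z) = 1" using z(2) by (simp add: graph_degree_def nbs_def)
  then obtain w where w: "nbs z = {w}" by (auto simp: card_1_singleton_iff)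
  then have wY: "w \<in> Y" using nY[OF z(1)] by simp
  have Ezw: "E z w" using w by (metis mem_nbs singletonI)
  have dz: "deg z = 1" using z(2) by (simp add: deg_def)
  have Ew: "E x w" if "x \<in> X" for x
  proof (rule ccontr)
    assume n: "\<not> E x w"
    then have "nbs x \<inter> nbs z = {}" using w by auto
    then have "common_weight x z = 0" by (simp add: common_weight_def)
    moreover have "x \<noteq> z" using n Ezw by auto
    ultimately have "c * deg x * deg z = 0" using cw[of x z] z that by simp
    then show False using c dz dpos[of x] that by simp
  qed
  have nw: "nbs w = X" using Ew nX[OF wY] E_sym by auto
  have dw: "deg w = m" by (simp add: deg_eq nw m_def)
  have m2: "m \<ge> 2" using X2 by (simp add: m_def)
  define X' where "X' = X - {z}"
  define Y' where "Y' = Y - {w}"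
  have cX': "card X' = m - 1" "card Y' = m - 1"
    using z wY fX card_eq by (auto simp: X'_def Y'_def m_def Y_def)
  have wz: "common_weight x z = 1 / m" if "x \<in> X" for x
  proof -
    have "nbs x \<inter> nbs z = {w}" using w Ew[OF that] by auto
    then show ?thesis by (simp add: common_weight_def dw)
  qed
  \<comment> \<open>The identity for the pair \<open>x\<close>, \<open>z\<close> reads
    \<open>1 / m = c * deg x\<close>, because \<open>w\<close> is their only common
    neighbour.\<close>
  have dX: "c * deg x * m = 1" if "x \<in> X'" for x
    using wz[of x] cw[of x z] that z dz m2 by (auto simp: X'_def field_simps)
  have "card X' \<noteq> 0" "card Y' \<noteq> 0" using cX' m2 by auto
  then obtain x0 y0 where x0: "x0 \<in> X'" and y0: "y0 \<in> Y'" by (metis card.empty ex_in_conv)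
  define k where "k = deg x0"
  have k: "c * k * m = 1" using dX[OF x0] by (simp add: k_def)
  have dXk: "deg x = k" if "x \<in> X'" for x
  proof -
    have "c * m * (deg x - k) = 0" using dX[OF that] k by (simp add: algebra_simps)
    then show ?thesis using c m2 by simp
  qed
  have kpos: "k > 0" using dpos[of x0] x0 by (auto simp: k_def X'_def)
  \<comment> \<open>Compares the identity for \<open>z\<close> with itself,
    \<open>1 / m = q + c\<close>, with \<open>1 / m = c * k\<close>.\<close>
  have qk: "q = c * (k - 1)"
  proof -
    have "1 / m = q + c" using wz[OF z(1)] cw[of z z] z dz by simp
    moreover have "1 / m = c * k" using k m2 by (simp add: field_simps)
    ultimately show ?thesis by (simp add: algebra_simps)
  qed
  have nY': "nbs y \<subseteq> X'" if "y \<in> Y'" for y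
  proof -
    have "\<not> E y z" using w that by (metis DiffE E_sym Y'_def mem_nbs)
    then show ?thesis using nX[of y] that by (auto simp: X'_def Y'_def)
  qed
  \<comment> \<open>All neighbours of \<open>y\<close> have degree \<open>k\<close>, so the diagonal
    identity reads \<open>deg y / k = q * deg y + c * deg y * deg y\<close>; cancel
    \<open>deg y\<close>.\<close>
  have dY: "deg y = m - k + 1" if y: "y \<in> Y'" for y
  proof -
    have "common_weight y y = (\<Sum>u\<in>nbs y. 1 / k)"
      unfolding common_weight_def by (intro sum.cong) (use nY'[OF y] dXk in auto)
    then have "deg y / k = q * deg y + c * deg y * deg y"
      using cw[of y y] y by (simp add: deg_eq Y'_def)
    then have "deg y * (1 / k) = deg y * (q + c * deg y)" by (simp add: algebra_simps)
    moreover have "deg y \<noteq> 0" using dpos[of y] y by (simp add: Y'_def)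
    ultimately have "1 / k = q + c * deg y" using mult_cancel_left by blast
    also have "\<dots> = c * (k - 1 + deg y)" by (simp add: qk algebra_simps)
    finally have "m * (c * k) = (c * k) * (k - 1 + deg y)" using kpos k by (simp add: field_simps)
    then have "m = k - 1 + deg y" using c kpos by simp
    then show ?thesis by simp
  qed
  \<comment> \<open>Counting the edges from both parts gives
    \<open>(m - 1) * (2 * k - 2 - m) = 0\<close>, and \<open>m >= 2\<close>.\<close>
  have mk: "real m = 2 * k - 2"
  proof -
    have "(\<Sum>x\<in>X. deg x) = 1 + (\<Sum>x\<in>X'. deg x)"
      unfolding X'_def using sum.remove[OF fX(1) z(1), of deg] dz by simp
    also have "(\<Sum>x\<in>X'. deg x) = (real m - 1) * k" using dXk cX' m2 by (simp add: of_nat_diff)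
    finally have 1: "(\<Sum>x\<in>X. deg x) = 1 + (real m - 1) * k" .
    have "(\<Sum>x\<in>Y. deg x) = m + (\<Sum>x\<in>Y'. deg x)"
      unfolding Y'_def using sum.remove[OF fX(2) wY, of deg] dw by simp
    also have "(\<Sum>x\<in>Y'. deg x) = (real m - 1) * (m - k + 1)" using dY cX' m2 by (simp add: of_nat_diff)
    finally have "1 + (real m - 1) * k = m + (real m - 1) * (m - k + 1)"
      using 1 sum_deg_parts unfolding Y_def by simp
    then have "(real m - 1) * (2 * k - 2 - m) = 0" by (simp add: algebra_simps)
    then show ?thesis using m2 by simp
  qed
  \<comment> \<open>The common degree on \<open>Y'\<close>, which is
    \<open>m - k + 1 = k - 1\<close>; hence \<open>m = 2 * s\<close>.\<close>
  define s where "s = card (nbs y0)"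
  have sk: "real s = k - 1" using dY[OF y0] mk by (simp add: s_def deg_eq)
  have ms: "m = 2 * s" using sk mk by linarith
  have s1: "s \<ge> 1" using m2 ms by simp
  have "card {y \<in> Y'. E x y} = s" if x: "x \<in> X'" for x
  proof -
    have "nbs x = insert w {y \<in> Y'. E x y}"
      using Ew[of x] nY[of x] x by (auto simp: X'_def Y'_def)
    then have "card (nbs x) = Suc (card {y \<in> Y'. E x y})"
      using fX by (simp add: Y'_def)
    then show ?thesis using dXk[OF x] sk by (simp add: deg_eq)
  qed
  moreover have sY: "card {x \<in> X'. E x y} = s" if y: "y \<in> Y'" for y
  proof -
    have "{x \<in> X'. E x y} = nbs y" using nY'[OF y] E_sym by auto
    then show ?thesis using dY[OF y] mk sk by (simp add: deg_eq)
  qed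
  moreover have "2 * card {y \<in> Y'. E x y \<and> E x' y} = s" if x: "x \<in> X'" "x' \<in> X'" "x \<noteq> x'" for x x'
  proof -
    let ?C = "{y \<in> Y'. E x y \<and> E x' y}"
    \<comment> \<open>Here \<open>w\<close> has degree \<open>2 * s\<close> and the members of
      \<open>?C\<close> have degree \<open>s\<close>, so the identity becomes
      \<open>1 / (2 * s) + card ?C / s = (1 + s) / (2 * s)\<close>.\<close>
    have "nbs x \<inter> nbs x' = insert w ?C"
      using Ew[of x] Ew[of x'] nY[of x] x by (auto simp: X'_def Y'_def)
    moreover have "finite ?C" "w \<notin> ?C" using fX by (auto simp: Y'_def)
    ultimately have "common_weight x x' = 1 / m + (\<Sum>y\<in>?C. 1 / deg y)"
      by (simp add: common_weight_def dw)
    also have "(\<Sum>y\<in>?C. 1 / deg y) = (\<Sum>y\<in>?C. 1 / s)"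
      using dY mk sk by (intro sum.cong) auto
    finally have "1 / m + card ?C / s = c * k * k"
      using cw[of x x'] x dXk by (simp add: X'_def)
    also have "c * k = 1 / m" using k m2 by (simp add: field_simps)
    finally have "1 / (2 * real s) + card ?C / s = (1 + s) / (2 * real s)"
      using sk by (simp add: ms)
    then have "2 * real (card ?C) = s" using s1 by (simp add: field_simps)
    then show ?thesis by linarith
  qed
  ultimately have "half_incidence E X' Y' s"
    using fX s1 cX' ms by (simp add: half_incidence_def X'_def Y'_def)
  then show ?thesis
    unfolding X'_def Y'_def Y_def using w nw wY by (auto simp: Y_def)
qed

lemma obtained_graph_if_half_incidence:
  assumes z: "z \<in> X" and w: "w \<in> {..<n} - X" and nz: "nbs z = {w}" and nw: "nbs w = X"
    and half: "half_incidence E (X - {z}) ({..<n} - X - {w}) s"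
  shows "obtained_graph n E"
proof -
  define A where "A = X - {z}"
  define B where "B = {..<n} - X - {w}"
  define W where "W = {0..<n} - {w, z}"
  define F where "F = (\<lambda>x y. x \<in> W \<and> y \<in> W \<and> E x y)"
  have fin: "finite A" "finite B" and s: "s \<ge> 1" and card: "card A = 2 * s - 1" "card B = 2 * s - 1"
    and degA: "\<And>x. x \<in> A \<Longrightarrow> card {y \<in> B. E x y} = s" and degB: "\<And>y. y \<in> B \<Longrightarrow> card {x \<in> A. E x y} = s"
    and pair: "\<And>x x'. x \<in> A \<Longrightarrow> x' \<in> A \<Longrightarrow> x \<noteq> x' \<Longrightarrow> 2 * card {y \<in> B. E x y \<and> E x' y} = s"
    using half by (auto simp: half_incidence_def A_def B_def)
  have W: "W = A \<union> B" and AB: "A \<inter> B = {}"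
    using X_subset z w by (auto simp: W_def A_def B_def)
  have ne: "A \<noteq> {}" "B \<noteq> {}" using card s by auto
  have zw: "w < n" "z < n" "w \<noteq> z" using z w X_subset by auto
  have Ez: "E z u \<longleftrightarrow> u = w" for u using nz by (metis mem_nbs singleton_iff)
  have Ew: "E w u \<longleftrightarrow> u = z \<or> u \<in> A" for u using nw z mem_nbs[of u w] by (auto simp: A_def)
  have cross: "x \<in> A \<longleftrightarrow> y \<notin> A" if "F x y" for x y
    using that E_cross[of x y] W by (auto simp: F_def A_def B_def)
  have cc: "is_color_class W F A"
    unfolding is_color_class_def using cross ne W AB by auto
  have "is_K2 W F \<or> (\<exists>t\<ge>1. \<exists>(P :: nat set) (I :: nat set) blk f. hadamard_design P I blk t \<and>
             graph_iso W F (incidence_vertices P I) (incidence_adj (complement_design P blk)) f)"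
  proof (cases "s = 1")
    case True
    then obtain a b where ab: "A = {a}" "B = {b}" using card by (auto simp: card_1_singleton_iff)
    have "E a b"
    proof (rule ccontr)
      assume "\<not> E a b"
      then have "{y \<in> B. E a y} = {}" using ab by auto
      moreover have "card {y \<in> B. E a y} = s" using ab by (intro degA) simp
      ultimately show False using s by (simp only: card.empty)
    qed
    moreover have "a \<noteq> b" using AB ab by auto
    ultimately have "is_K2 W F"
      unfolding is_K2_def by (intro exI[of _ a] exI[of _ b]) (auto simp: W ab F_def)
    then show ?thesis ..
  next
    case False
    then have "card A \<ge> 2" using card s by simp
    \<comment> \<open>The pair count of two distinct points forces \<open>s\<close> to be
      even.\<close>
    then obtain x x' where "x \<in> A" "x' \<in> A" "x \<noteq> x'"
      by (metis One_nat_def Suc_1 card_le_Suc0_iff_eq fin(1) not_less_eq_eq)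
    from pair[OF this] obtain t where t: "s = 2 * t" by (metis)
    have t1: "t \<ge> 1" using s t by simp
    \<comment> \<open>Blocks consist of non-neighbours, so that the complementary design recovers
      adjacency.\<close>
    define blk where "blk y = A - nbs y" for y
    define f :: "nat \<Rightarrow> nat + nat" where "f x = (if x \<in> A then Inl x else Inr x)" for x
    have "hadamard_design A B blk t"
      unfolding hadamard_design_def symmetric_bibd_def bibd_def
    proof (intro conjI ballI impI)
      show "card A = 4 * t - 1" "card B = 4 * t - 1" using card t by auto
      fix y assume y: "y \<in> B"
      have "blk y = A - {x \<in> A. E x y}" by (auto simp: blk_def E_sym)
      then show "card (blk y) = 2 * t - 1"
        using degB[OF y] fin card t by (simp add: card_Diff_subset)
    next
      fix x assume x: "x \<in> A"
      have "{y \<in> B. x \<in> blk y} = B - {y \<in> B. E x y}" using x by (auto simp: blk_def E_sym)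
      then show "card {y \<in> B. x \<in> blk y} = 2 * t - 1"
        using degA[OF x] fin card t by (simp add: card_Diff_subset)
    next
      fix x x' assume x: "x \<in> A" "x' \<in> A" "x \<noteq> x'"
      let ?N = "{y \<in> B. E x y}" and ?N' = "{y \<in> B. E x' y}"
      have "?N \<inter> ?N' = {y \<in> B. E x y \<and> E x' y}" by auto
      then have "card (?N \<inter> ?N') = t" using pair[OF x] t by simp
      moreover have "card ?N + card ?N' = card (?N \<union> ?N') + card (?N \<inter> ?N')"
        by (rule card_Un_Int) (use fin in auto)
      \<comment> \<open>Inclusion-exclusion: \<open>2 * t + 2 * t - t\<close> vertices of
        \<open>B\<close> are adjacent to \<open>x\<close> or \<open>x'\<close>, which leaves
        \<open>t - 1\<close> of the \<open>4 * t - 1\<close>.\<close>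
      ultimately have "card (?N \<union> ?N') = 3 * t" using degA x t by simp
      moreover have "{y \<in> B. x \<in> blk y \<and> x' \<in> blk y} = B - (?N \<union> ?N')"
        using x by (auto simp: blk_def E_sym)
      moreover have "card (B - (?N \<union> ?N')) = card B - card (?N \<union> ?N')"
        by (rule card_Diff_subset) (use fin in auto)
      ultimately show "card {y \<in> B. x \<in> blk y \<and> x' \<in> blk y} = t - 1"
        using card t by simp
    qed (use fin in \<open>auto simp: blk_def\<close>)
    moreover have "graph_iso W F (incidence_vertices A B) (incidence_adj (complement_design A blk)) f"
      unfolding graph_iso_def
    proof
      show "bij_betw f W (incidence_vertices A B)"
        unfolding bij_betw_def incidence_vertices_def W using AB
        by (auto simp: inj_on_def f_def image_iff)
      show "\<forall>x\<in>W. \<forall>y\<in>W. F x y = incidence_adj (complement_design A blk) (f x) (f y)"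
      proof (intro ballI)
        fix x y assume xy: "x \<in> W" "y \<in> W"
        then have "F x y \<longleftrightarrow> E x y" by (simp add: F_def)
        moreover have "\<not> F x y" if "x \<in> A \<longleftrightarrow> y \<in> A" using cross that by blast
        ultimately show "F x y = incidence_adj (complement_design A blk) (f x) (f y)"
          by (cases "x \<in> A"; cases "y \<in> A") (auto simp: f_def complement_design_def blk_def E_sym)
      qed
    qed
    ultimately show ?thesis using t1 by blast
  qed
  then show ?thesis
    unfolding obtained_graph_def
    by (intro exI[of _ w] exI[of _ z] exI[of _ A])
      (unfold Let_def, fold W_def, fold F_def, use zw Ez Ew cc in simp)
qed

end

section \<open>Relabelling, Hadamard complements and color classes of incidence structures\<close>

lemma card_filter_bij_betw:
  assumes "bij_betw h B' B" "\<And>y. y \<in> B' \<Longrightarrow> P y \<longleftrightarrow> Q (h y)"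
  shows "card {y \<in> B'. P y} = card {y \<in> B. Q y}"
proof (rule bij_betw_same_card)
  show "bij_betw h {y \<in> B'. P y} {y \<in> B. Q y}"
    using assms unfolding bij_betw_def by (auto simp: inj_on_def)
qed

lemma half_incidence_transfer:
  assumes half: "half_incidence R A B s" and g: "bij_betw g A' A" and h: "bij_betw h B' B"
    and R: "\<And>x y. x \<in> A' \<Longrightarrow> y \<in> B' \<Longrightarrow> R' x y \<longleftrightarrow> R (g x) (h y)"
  shows "half_incidence R' A' B' s"
proof -
  have gA: "g x \<in> A" if "x \<in> A'" for x using g that by (auto simp: bij_betw_def)
  have hB: "h y \<in> B" if "y \<in> B'" for y using h that by (auto simp: bij_betw_def)
  have g_inj: "g x \<noteq> g x'" if "x \<in> A'" "x' \<in> A'" "x \<noteq> x'" for x x'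
    using g that by (auto simp: bij_betw_def inj_on_def)
  have "card {y \<in> B'. R' x y} = s" if "x \<in> A'" for x
    using card_filter_bij_betw[OF h, of "R' x" "R (g x)"] R half gA that by (simp add: half_incidence_def)
  moreover have "card {x \<in> A'. R' x y} = s" if "y \<in> B'" for y
    using card_filter_bij_betw[OF g, of "\<lambda>x. R' x y" "\<lambda>x. R x (h y)"] R half hB that
    by (simp add: half_incidence_def)
  moreover have "2 * card {y \<in> B'. R' x y \<and> R' x' y} = s" if "x \<in> A'" "x' \<in> A'" "x \<noteq> x'" for x x'
    using card_filter_bij_betw[OF h, of "\<lambda>y. R' x y \<and> R' x' y" "\<lambda>y. R (g x) y \<and> R (g x') y"]
      R half gA g_inj that by (simp add: half_incidence_def)
  moreover have "finite A'" "finite B'" "card A' = card A" "card B' = card B"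
    using half g h bij_betw_finite bij_betw_same_card unfolding half_incidence_def by blast+
  ultimately show ?thesis using half by (simp add: half_incidence_def)
qed

text \<open>Inclusion-exclusion: \<open>2 * (2 * t - 1) - (t - 1) = 3 * t - 1\<close> blocks contain
  at least one of two given points, so \<open>t\<close> of the \<open>4 * t - 1\<close> blocks avoid
  both.\<close>

lemma half_incidence_complement_hadamard:
  assumes "hadamard_design P I blk t" "t \<ge> 1"
  shows "half_incidence (\<lambda>x i. x \<in> complement_design P blk i) P I (2 * t)"
proof -
  have fin: "finite P" "finite I" and card: "card P = 4 * t - 1" "card I = 4 * t - 1"
    and blk: "\<And>i. i \<in> I \<Longrightarrow> blk i \<subseteq> P \<and> card (blk i) = 2 * t - 1"
    and r: "\<And>x. x \<in> P \<Longrightarrow> card {i \<in> I. x \<in> blk i} = 2 * t - 1"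
    and pair: "\<And>x y. x \<in> P \<Longrightarrow> y \<in> P \<Longrightarrow> x \<noteq> y \<Longrightarrow> card {i \<in> I. x \<in> blk i \<and> y \<in> blk i} = t - 1"
    using assms(1) unfolding hadamard_design_def symmetric_bibd_def bibd_def by auto
  have "card {i \<in> I. x \<in> complement_design P blk i} = 2 * t" if x: "x \<in> P" for x
  proof -
    have "{i \<in> I. x \<in> complement_design P blk i} = I - {i \<in> I. x \<in> blk i}"
      using x by (auto simp: complement_design_def)
    then show ?thesis using fin card r[OF x] assms(2) by (simp add: card_Diff_subset)
  qed
  moreover have "card {x \<in> P. x \<in> complement_design P blk i} = 2 * t" if i: "i \<in> I" for i
  proof -
    have "{x \<in> P. x \<in> complement_design P blk i} = P - blk i" by (auto simp: complement_design_def)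
    moreover have "finite (blk i)" using blk[OF i] fin finite_subset by blast
    ultimately show ?thesis using fin card blk[OF i] assms(2) by (simp add: card_Diff_subset)
  qed
  moreover have "card {i \<in> I. x \<in> complement_design P blk i \<and> y \<in> complement_design P blk i} = t"
    if x: "x \<in> P" "y \<in> P" "x \<noteq> y" for x y
  proof -
    let ?N = "{i \<in> I. x \<in> blk i}" and ?N' = "{i \<in> I. y \<in> blk i}"
    have "?N \<inter> ?N' = {i \<in> I. x \<in> blk i \<and> y \<in> blk i}" by auto
    then have "card (?N \<inter> ?N') = t - 1" using pair[OF x] by simp
    moreover have "card ?N + card ?N' = card (?N \<union> ?N') + card (?N \<inter> ?N')"
      by (rule card_Un_Int) (use fin in auto)
    ultimately have "card (?N \<union> ?N') = 3 * t - 1" using r x assms(2) by simp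
    moreover have "{i \<in> I. x \<in> complement_design P blk i \<and> y \<in> complement_design P blk i} = I - (?N \<union> ?N')"
      using x by (auto simp: complement_design_def)
    moreover have "card (I - (?N \<union> ?N')) = card I - card (?N \<union> ?N')"
      by (rule card_Diff_subset) (use fin in auto)
    ultimately show ?thesis using card assms(2) by simp
  qed
  ultimately show ?thesis using fin card assms(2) by (simp add: half_incidence_def)
qed

text \<open>Two distinct points share a block because \<open>s >= 1\<close>, hence lie on the same
  side; every block contains a point, hence lies on the other side. So joining \<open>w\<close> to a
  color class means joining it to all points or to all blocks.\<close>

lemma color_class_half_incidence:
  assumes half: "half_incidence R A B s" and S: "is_color_class (A \<union> B) F S"
    and F: "\<And>x y. x \<in> A \<Longrightarrow> y \<in> B \<Longrightarrow> R x y \<Longrightarrow> F x y" and AB: "A \<inter> B = {}"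
  shows "S = A \<or> S = B"
proof -
  have s: "s \<ge> 1" and degB: "\<And>y. y \<in> B \<Longrightarrow> card {x \<in> A. R x y} = s"
    and pair: "\<And>x x'. x \<in> A \<Longrightarrow> x' \<in> A \<Longrightarrow> x \<noteq> x' \<Longrightarrow> 2 * card {y \<in> B. R x y \<and> R x' y} = s"
    using half by (auto simp: half_incidence_def)
  have opp: "x \<in> S \<longleftrightarrow> y \<notin> S" if "x \<in> A" "y \<in> B" "R x y" for x y
    using S F[OF that] that unfolding is_color_class_def by blast
  have same: "x \<in> S \<longleftrightarrow> x' \<in> S" if x: "x \<in> A" "x' \<in> A" for x x'
  proof (cases "x = x'")
    case False
    have "card {y \<in> B. R x y \<and> R x' y} \<noteq> 0" using pair[OF x False] s by linarith
    then have "{y \<in> B. R x y \<and> R x' y} \<noteq> {}" by (metis card.empty)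
    then show ?thesis using opp x by blast
  qed simp
  have nb: "\<exists>x\<in>A. R x y" if "y \<in> B" for y
  proof -
    have "card {x \<in> A. R x y} \<noteq> 0" using degB[OF that] s by linarith
    then have "{x \<in> A. R x y} \<noteq> {}" by (metis card.empty)
    then show ?thesis by blast
  qed
  have SAB: "S \<subseteq> A \<union> B" using S by (simp add: is_color_class_def)
  show ?thesis
  proof (cases "\<exists>x\<in>A. x \<in> S")
    case True
    then have "A \<subseteq> S" using same by blast
    moreover have "y \<notin> S" if "y \<in> B" for y using nb[OF that] opp that calculation by blast
    ultimately show ?thesis using SAB by blast
  next
    case False
    then have "y \<in> S" if "y \<in> B" for y using nb[OF that] opp that by blast
    then show ?thesis using SAB False by blast
  qed
qed

text \<open>For a symmetric relation the dual structure uses the same relation, so points and blocks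
  may change places.\<close>

lemma half_incidence_sym:
  assumes "half_incidence E A B s" "\<And>x y. E x y \<longleftrightarrow> E y x"
  shows "half_incidence E B A s"
proof -
  have "(\<lambda>y x. E x y) = E" using assms(2) by blast
  then show ?thesis using half_incidence_dual[OF assms(1)] by simp
qed

section \<open>From incidence structures back to the walk identity\<close>

context connected_bipartite_graph
begin

text \<open>The degrees are 1 at \<open>z\<close>, \<open>2 * s\<close> at \<open>w\<close>,
  \<open>s + 1\<close> on the rest of \<open>X\<close> and \<open>s\<close> on the rest of the other
  part. The constants come from the forward direction, \<open>c * k * m = 1\<close> and
  \<open>q = c * (k - 1)\<close>, with \<open>k = s + 1\<close> and \<open>m = 2 * s\<close>. The
  identity is then checked for each kind of pair.\<close>

lemma walk_identity_if_half_incidence: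
  assumes z: "z \<in> X" and w: "w \<in> {..<n} - X" and nz: "nbs z = {w}" and nw: "nbs w = X"
    and half: "half_incidence E (X - {z}) ({..<n} - X - {w}) s"
  shows "walk_identity (1 / (2 * (real s + 1))) (1 / (2 * real s * (real s + 1)))" and "card X = 2 * s"
proof -
  define A where "A = X - {z}"
  define B where "B = {..<n} - X - {w}"
  have hAB: "half_incidence E A B s" using half by (simp add: A_def B_def)
  \<comment> \<open>Duality supplies the pair counts for the part of \<open>w\<close>.\<close>
  have hBA: "half_incidence E B A s" by (rule half_incidence_sym[OF hAB E_sym])
  have fin: "finite A" "finite B" and s: "s \<ge> 1" and card: "card A = 2 * s - 1"
    and degA: "\<And>x. x \<in> A \<Longrightarrow> card {y \<in> B. E x y} = s"
    and pairA: "\<And>x x'. x \<in> A \<Longrightarrow> x' \<in> A \<Longrightarrow> x \<noteq> x' \<Longrightarrow> 2 * card {y \<in> B. E x y \<and> E x' y} = s"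
    using hAB by (auto simp: half_incidence_def)
  have degB: "\<And>x. x \<in> B \<Longrightarrow> card {y \<in> A. E x y} = s"
    and pairB: "\<And>x x'. x \<in> B \<Longrightarrow> x' \<in> B \<Longrightarrow> x \<noteq> x' \<Longrightarrow> 2 * card {y \<in> A. E x y \<and> E x' y} = s"
    using hBA by (auto simp: half_incidence_def)
  have XA: "X = insert z A" "z \<notin> A" using z by (auto simp: A_def)
  have YB: "{..<n} - X = insert w B" "w \<notin> B" using w by (auto simp: B_def)
  show cardX: "card X = 2 * s" using XA fin card s by simp
  have nA: "nbs x = insert w {y \<in> B. E x y}" if "x \<in> A" for x
  proof -
    have "E x w" using that nw XA(1) by (metis E_sym insertCI mem_nbs)
    moreover have "y \<in> insert w B" if "E x y" for y
      using E_cross[OF that] E_less[OF that] XA(1) YB(1) \<open>x \<in> A\<close> by blast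
    ultimately show ?thesis by (simp add: set_eq_iff) blast
  qed
  have nB: "nbs y = {x \<in> A. E y x}" if "y \<in> B" for y
  proof -
    have "\<not> E y z" using that nz YB(2) by (metis E_sym mem_nbs singletonD)
    moreover have "x \<in> insert z A" if "E y x" for x
      using E_cross[OF that] XA(1) YB(1) \<open>y \<in> B\<close> by blast
    ultimately show ?thesis by (simp add: set_eq_iff) blast
  qed
  have dz: "deg z = 1" by (simp add: deg_eq nz)
  have dw: "deg w = 2 * s" by (simp add: deg_eq nw cardX)
  have dA: "deg x = s + 1" if "x \<in> A" for x
    using nA[OF that] degA[OF that] fin YB(2) by (simp add: deg_eq)
  have dB: "deg y = s" if "y \<in> B" for y
    using nB[OF that] degB[OF that] by (simp add: deg_eq)
  have spos: "real s > 0" using s by simp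
  have czz: "common_weight z z = 1 / (2 * s)" by (simp add: common_weight_def nz dw)
  have cAz: "common_weight x z = 1 / (2 * s)" if "x \<in> A" for x
  proof -
    have "nbs x \<inter> nbs z = {w}" using nA[OF that] nz by auto
    then show ?thesis by (simp add: common_weight_def dw)
  qed
  have sumB: "(\<Sum>y\<in>{y \<in> B. Q y}. 1 / deg y) = card {y \<in> B. Q y} / s" for Q
    by (subst sum.cong[where h = "\<lambda>_. 1 / real s"]) (auto simp: dB)
  have sumA: "(\<Sum>x\<in>{x \<in> A. Q x}. 1 / deg x) = card {x \<in> A. Q x} / (real s + 1)" for Q
    by (subst sum.cong[where h = "\<lambda>_. 1 / (real s + 1)"]) (auto simp: dA add.commute)
  have cAA: "common_weight x x' = 1 / (2 * s) + card {y \<in> B. E x y \<and> E x' y} / s" if "x \<in> A" "x' \<in> A" for x x'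
  proof -
    have "nbs x \<inter> nbs x' = insert w {y \<in> B. E x y \<and> E x' y}" using nA that by auto
    then show ?thesis using fin YB(2) sumB by (simp add: common_weight_def dw)
  qed
  have cAA1: "common_weight x x = 1 / (2 * s) + 1" if "x \<in> A" for x
    using cAA[OF that that] degA[OF that] spos by simp
  have cAA2: "common_weight x x' = 1 / (2 * s) + 1 / 2" if x: "x \<in> A" "x' \<in> A" "x \<noteq> x'" for x x'
  proof -
    have "real (card {y \<in> B. E x y \<and> E x' y}) = s / 2" using pairA[OF x] by linarith
    then show ?thesis using cAA[OF x(1,2)] spos by simp
  qed
  have cBB: "common_weight y y' = card {x \<in> A. E y x \<and> E y' x} / (real s + 1)" if "y \<in> B" "y' \<in> B" for y y'
  proof -
    have "nbs y \<inter> nbs y' = {x \<in> A. E y x \<and> E y' x}" using nB that by auto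
    then show ?thesis using sumA by (simp add: common_weight_def)
  qed
  have cBB1: "common_weight y y = s / (real s + 1)" if "y \<in> B" for y
    using cBB[OF that that] degB[OF that] by simp
  have cBB2: "common_weight y y' = s / (2 * (real s + 1))" if y: "y \<in> B" "y' \<in> B" "y \<noteq> y'" for y y'
  proof -
    have "real (card {x \<in> A. E y x \<and> E y' x}) = s / 2" using pairB[OF y] by linarith
    then show ?thesis unfolding cBB[OF y(1,2)] by (simp only: divide_divide_eq_left)
  qed
  have cBw: "common_weight y w = s / (real s + 1)" if "y \<in> B" for y
  proof -
    have "nbs y \<inter> nbs w = {x \<in> A. E y x}" using nB[OF that] nw XA by auto
    then show ?thesis using sumA degB[OF that] by (simp add: common_weight_def)
  qed
  \<comment> \<open>The neighbour \<open>z\<close> contributes 1, each of the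
    \<open>2 * s - 1\<close> vertices of \<open>A\<close> contributes
    \<open>1 / (s + 1)\<close>.\<close>
  have cww: "common_weight w w = 3 * s / (real s + 1)"
  proof -
    have "common_weight w w = 1 + (2 * real s - 1) / (real s + 1)"
      using sumA[of "\<lambda>_. True"] fin XA card s by (simp add: common_weight_def nw dz of_nat_diff)
    then show ?thesis by (simp add: field_simps)
  qed
  define r where "r = real s"
  define q c where "q = 1 / (2 * (real s + 1))" and "c = 1 / (2 * real s * (real s + 1))"
  have r: "r > 0" "r \<noteq> 0" "r + 1 \<noteq> 0" using spos by (auto simp: r_def)
  have c: "c = 1 / (2 * r * (r + 1))" by (simp add: c_def r_def)
  have q: "q = r * c" using r by (simp add: q_def c flip: r_def)
  have one: "2 * c * r * (r + 1) = 1" using r by (simp add: c)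
  \<comment> \<open>The weights become \<open>c\<close> times polynomials in \<open>r\<close>, so
    that the cases below are ring identities; the summand 1 on the diagonal of \<open>A\<close> is
    handled by \<open>one\<close>.\<close>
  have weights: "1 / (2 * s) = c * (r + 1)" "1 / 2 = c * r * (r + 1)" "s / (real s + 1) = 2 * r * r * c"
    "s / (2 * (real s + 1)) = r * r * c"
    using r by (simp_all add: c flip: r_def)
  then have weight3: "3 * s / (real s + 1) = 6 * r * r * c" by simp
  have d: "deg z = 1" "deg w = 2 * r" "\<And>x. x \<in> A \<Longrightarrow> deg x = r + 1" "\<And>y. y \<in> B \<Longrightarrow> deg y = r"
    using dz dw dA dB by (auto simp: r_def)
  let ?rhs = "\<lambda>x y. (if x = y then q * deg x else 0) + c * deg x * deg y"
  have idX: "common_weight x y = ?rhs x y" if xy: "x \<in> insert z A" "y \<in> insert z A" for x y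
  proof -
    consider "x = z" "y = z" | "x \<in> A" "y = z" "x \<noteq> y" | "x = z" "y \<in> A" "x \<noteq> y"
      | "x \<in> A" "y = x" | "x \<in> A" "y \<in> A" "x \<noteq> y"
      using xy by blast
    then show ?thesis
    proof cases
      case 1
      then show ?thesis by (simp only: czz weights d q) (simp add: algebra_simps)
    next
      case 2
      then show ?thesis by (simp only: cAz weights d) simp
    next
      case 3
      then show ?thesis by (simp only: common_weight_commute[of z] cAz weights d) simp
    next
      case 4
      have "c * (r + 1) + 2 * c * r * (r + 1) = r * c * (r + 1) + c * (r + 1) * (r + 1)"
        by (simp add: algebra_simps)
      then have "c * (r + 1) + 1 = r * c * (r + 1) + c * (r + 1) * (r + 1)" by (simp only: one)
      then show ?thesis using 4 by (simp only: cAA1 weights d q simp_thms if_True)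
    next
      case 5
      have "c * (r + 1) + c * r * (r + 1) = c * (r + 1) * (r + 1)" by (simp add: algebra_simps)
      then show ?thesis using 5 by (simp only: cAA2 weights d q simp_thms if_False add_0_left)
    qed
  qed
  have idY: "common_weight x y = ?rhs x y" if xy: "x \<in> insert w B" "y \<in> insert w B" for x y
  proof -
    consider "x = w" "y = w" | "x \<in> B" "y = w" "x \<noteq> y" | "x = w" "y \<in> B" "x \<noteq> y"
      | "x \<in> B" "y = x" | "x \<in> B" "y \<in> B" "x \<noteq> y"
      using xy by blast
    then show ?thesis
    proof cases
      case 1
      then show ?thesis by (simp only: cww weight3 d q) (simp add: algebra_simps)
    next
      case 2
      then show ?thesis by (simp only: cBw weights d q) (simp add: algebra_simps)
    next
      case 3
      then show ?thesis
        by (simp only: common_weight_commute[of w] cBw weights d q) (simp add: algebra_simps)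
    next
      case 4
      then show ?thesis by (simp only: cBB1 weights d q) (simp add: algebra_simps)
    next
      case 5
      then show ?thesis by (simp only: cBB2 weights d q simp_thms) (simp add: algebra_simps)
    qed
  qed
  have "walk_identity q c"
    unfolding walk_identity_def
  proof (intro allI impI)
    fix x y assume "x < n" "y < n" "x \<in> X \<longleftrightarrow> y \<in> X"
    then have "x \<in> insert z A \<and> y \<in> insert z A \<or> x \<in> insert w B \<and> y \<in> insert w B"
      using XA(1) YB(1) by blast
    then show "common_weight x y = ?rhs x y" using idX idY by blast
  qed
  then show "walk_identity (1 / (2 * (real s + 1))) (1 / (2 * real s * (real s + 1)))"
    by (simp only: q_def c_def)
qed

end

section \<open>Incidence structures inside the described graphs\<close>

context connected_simple_graph
begin

lemma half_incidence_if_obtained_graph: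
  assumes "obtained_graph n E"
  shows "\<exists>X z w s. connected_bipartite_graph n E X \<and> z \<in> X \<and> w \<in> {..<n} - X \<and> nbs z = {w} \<and> nbs w = X \<and>
    half_incidence E (X - {z}) ({..<n} - X - {w}) s"
proof -
  obtain w z S where zw: "w < n" "z < n" "w \<noteq> z" "E w z" "\<forall>u<n. E z u \<longleftrightarrow> u = w" "\<forall>u<n. E w u \<longleftrightarrow> u = z \<or> u \<in> S"
    and rest: "let W = {0..<n} - {w, z}; F = (\<lambda>x y. x \<in> W \<and> y \<in> W \<and> E x y) in
         is_color_class W F S \<and>
         (is_K2 W F \<or>
          (\<exists>t\<ge>1. \<exists>(P :: nat set) (I :: nat set) blk f.
             hadamard_design P I blk t \<and>
             graph_iso W F (incidence_vertices P I)
               (incidence_adj (complement_design P blk)) f))"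
    using assms unfolding obtained_graph_def by blast
  define W where "W = {0..<n} - {w, z}"
  define F where "F = (\<lambda>x y. x \<in> W \<and> y \<in> W \<and> E x y)"
  have cc: "is_color_class W F S" and alt: "is_K2 W F \<or> (\<exists>t\<ge>1. \<exists>(P :: nat set) (I :: nat set) blk f.
             hadamard_design P I blk t \<and>
             graph_iso W F (incidence_vertices P I) (incidence_adj (complement_design P blk)) f)"
    using rest unfolding Let_def W_def[symmetric] F_def[symmetric] by blast+
  \<comment> \<open>Both alternatives yield the same kind of structure, with \<open>s = 1\<close>
    for K2 and \<open>s = 2 * t\<close> otherwise.\<close>
  have "\<exists>A B s. half_incidence E A B s \<and> W = A \<union> B \<and> A \<inter> B = {}"
    using alt
  proof
    assume "is_K2 W F"
    then obtain a b where ab: "W = {a, b}" "a \<noteq> b" "E a b" by (auto simp: is_K2_def F_def)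
    then have "{y \<in> {b}. E a y} = {b}" "{x \<in> {a}. E x b} = {a}" by auto
    then have "half_incidence E {a} {b} 1" by (simp add: half_incidence_def)
    then show ?thesis using ab by blast
  next
    assume "\<exists>t\<ge>1. \<exists>(P :: nat set) (I :: nat set) blk f. hadamard_design P I blk t \<and>
             graph_iso W F (incidence_vertices P I) (incidence_adj (complement_design P blk)) f"
    then obtain t and P I :: "nat set" and blk f where t: "t \<ge> 1" "hadamard_design P I blk t"
      and iso: "graph_iso W F (incidence_vertices P I) (incidence_adj (complement_design P blk)) f"
      by blast
    have bij: "bij_betw f W (Inl ` P \<union> Inr ` I)"
      and adj: "\<And>x y. x \<in> W \<Longrightarrow> y \<in> W \<Longrightarrow> F x y \<longleftrightarrow> incidence_adj (complement_design P blk) (f x) (f y)"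
      using iso by (auto simp: graph_iso_def incidence_vertices_def)
    define g where "g = inv_into W f"
    have gW: "bij_betw g (Inl ` P \<union> Inr ` I) W" unfolding g_def by (rule bij_betw_inv_into[OF bij])
    have fg: "f (g u) = u" if "u \<in> Inl ` P \<union> Inr ` I" for u
      unfolding g_def using bij that by (simp add: bij_betw_inv_into_right)
    \<comment> \<open>The preimages of the points and of the blocks under the isomorphism
      \<open>f\<close>.\<close>
    define A B where "A = g ` Inl ` P" and "B = g ` Inr ` I"
    have W: "W = A \<union> B"
      using gW unfolding A_def B_def bij_betw_def image_Un by simp
    have "A \<inter> B = g ` (Inl ` P \<inter> Inr ` I)"
      unfolding A_def B_def using gW
      by (intro inj_on_image_Int[of g "Inl ` P \<union> Inr ` I", symmetric]) (auto simp: bij_betw_def)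
    then have disj: "A \<inter> B = {}" by auto
    have "bij_betw (\<lambda>x. projl (f x)) A P"
      by (rule bij_betw_byWitness[where f' = "\<lambda>p. g (Inl p)"]) (auto simp: A_def fg)
    moreover have "bij_betw (\<lambda>x. projr (f x)) B I"
      by (rule bij_betw_byWitness[where f' = "\<lambda>p. g (Inr p)"]) (auto simp: B_def fg)
    moreover have "E x y \<longleftrightarrow> projl (f x) \<in> complement_design P blk (projr (f y))" if "x \<in> A" "y \<in> B" for x y
    proof -
      have "E x y \<longleftrightarrow> F x y" using that W by (auto simp: F_def)
      also have "\<dots> \<longleftrightarrow> incidence_adj (complement_design P blk) (f x) (f y)" using that W by (intro adj) auto
      also have "\<dots> \<longleftrightarrow> projl (f x) \<in> complement_design P blk (projr (f y))"
        using that by (auto simp: A_def B_def fg)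
      finally show ?thesis .
    qed
    ultimately have "half_incidence E A B (2 * t)"
      by (rule half_incidence_transfer[OF half_incidence_complement_hadamard[OF t(2,1)]])
    then show ?thesis using W disj by blast
  qed
  then obtain A B s where AB: "half_incidence E A B s" "W = A \<union> B" "A \<inter> B = {}" by blast
  have "S = A \<or> S = B"
    using cc unfolding AB(2) by (rule color_class_half_incidence[OF AB(1) _ _ AB(3)]) (auto simp: F_def AB(2))
  \<comment> \<open>If \<open>S\<close> is the class of the blocks, duality lets it take the place
    of the points.\<close>
  then have half: "half_incidence E S (W - S) s"
  proof
    assume "S = A"
    moreover have "W - A = B" using AB by auto
    ultimately show ?thesis using AB(1) by simp
  next
    assume "S = B"
    moreover have "W - B = A" using AB by auto
    ultimately show ?thesis using half_incidence_sym[OF AB(1) E_sym] by simp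
  qed
  have SW: "S \<subseteq> W" using cc by (simp add: is_color_class_def)
  have Ez: "E z u \<longleftrightarrow> u = w" for u using zw E_less by blast
  have Ew: "E w u \<longleftrightarrow> u = z \<or> u \<in> S" for u using zw E_less SW by (auto simp: W_def)
  \<comment> \<open>\<open>w\<close> is adjacent to \<open>z\<close> and to all of \<open>S\<close>,
    so these lie in one part.\<close>
  define X where "X = insert z S"
  have XS: "X - {z} = S" "{..<n} - X - {w} = W - S" "w \<in> {..<n} - X"
    using SW zw by (auto simp: X_def W_def)
  have "x \<in> X \<longleftrightarrow> y \<notin> X" if xy: "E x y" for x y
  proof (cases "x \<in> W \<and> y \<in> W")
    case True
    then have "x \<in> S \<longleftrightarrow> y \<notin> S" using cc that by (auto simp: is_color_class_def F_def)
    then show ?thesis using True by (auto simp: X_def W_def)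
  next
    case False
    then consider "x = w" | "x = z" | "y = w" | "y = z" using E_less[OF xy] by (auto simp: W_def)
    then show ?thesis
      using xy Ez Ew E_sym XS(3) unfolding X_def by cases (metis DiffD2 insert_iff)+
  qed
  then have "connected_bipartite_graph n E X"
    using SW zw by unfold_locales (auto simp: X_def W_def)
  moreover have "nbs z = {w}" "nbs w = X" using Ez Ew by (auto simp: X_def)
  ultimately show ?thesis using half XS by (intro exI[of _ X] exI[of _ z] exI[of _ w] exI[of _ s]) (simp add: X_def)
qed

end

theorem theorem3p1:
  fixes n :: nat and E :: "nat \<Rightarrow> nat \<Rightarrow> bool"
  assumes "simple_graph n E"
    and "connected_graph n E"
    and "bipartite_graph n E"
    and "\<exists>v<n. graph_degree n E v = 1"
  shows "card (nlap_eigenvalues n E) = 4 \<longleftrightarrow> obtained_graph n E"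
proof -
  obtain z where z: "z < n" "graph_degree n E z = 1" using assms(4) by blast
  \<comment> \<open>The neighbour of \<open>z\<close> is a second vertex, which gives the bound
    \<open>n >= 2\<close> of the locale.\<close>
  then obtain u where "u < n" "E z u" by (auto simp: graph_degree_def card_1_singleton_iff)
  moreover have "u \<noteq> z" using calculation assms(1) by (auto simp: simple_graph_def)
  ultimately have "n \<ge> 2" using z(1) by linarith
  interpret connected_simple_graph n E by unfold_locales fact+
  show ?thesis
  proof
    assume "card (nlap_eigenvalues n E) = 4"
    then have four: "card {l. walk_eigenvalue l} = 4" by (simp add: card_nlap_eigenvalues)
    obtain S where S: "\<forall>x<n. \<forall>y<n. E x y \<longrightarrow> (x \<in> S \<longleftrightarrow> y \<notin> S)"
      using assms(3) by (auto simp: bipartite_graph_def)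
    \<comment> \<open>The side of the bipartition that contains \<open>z\<close>, cut down to the
      vertex set.\<close>
    define X where "X = {x. x < n \<and> (x \<in> S \<longleftrightarrow> z \<in> S)}"
    have "x \<in> X \<longleftrightarrow> y \<notin> X" if "E x y" for x y
      using S E_less[OF that] that unfolding X_def by blast
    then interpret connected_bipartite_graph n E X
      by unfold_locales (auto simp: X_def)
    have zX: "z \<in> X" using z by (simp add: X_def)
    obtain q c where "0 < q" "q < 1" "0 < c" "walk_identity q c" "card X = card ({..<n} - X)" "card X \<ge> 2"
      using walk_identity_if_four_eigenvalues[OF four] by blast
    then obtain w s where "w \<in> {..<n} - X" "nbs z = {w}" "nbs w = X"
      "half_incidence E (X - {z}) ({..<n} - X - {w}) s"
      using half_incidence_if_walk_identity[of q c z] zX z(2) by blast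
    then show "obtained_graph n E" by (rule obtained_graph_if_half_incidence[OF zX])
  next
    assume "obtained_graph n E"
    then obtain X z w s where bip: "connected_bipartite_graph n E X"
      and h: "z \<in> X" "w \<in> {..<n} - X" "nbs z = {w}" "nbs w = X" "half_incidence E (X - {z}) ({..<n} - X - {w}) s"
      using half_incidence_if_obtained_graph by blast
    interpret connected_bipartite_graph n E X by (rule bip)
    have s: "s \<ge> 1" using h(5) by (simp add: half_incidence_def)
    \<comment> \<open>For \<open>s >= 1\<close> the constant \<open>1 / (2 * (s + 1))\<close> lies
      strictly between 0 and 1, and \<open>card X = 2 * s\<close> is at least 2.\<close>
    have "card {l. walk_eigenvalue l} = 4"
      by (rule four_eigenvalues_if_walk_identity[OF walk_identity_if_half_incidence(1)[OF h]])
        (use s walk_identity_if_half_incidence(2)[OF h] in \<open>auto simp: field_simps\<close>)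
    then show "card (nlap_eigenvalues n E) = 4" by (simp add: card_nlap_eigenvalues)
  qed
qed

end
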